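(* Let $k$ be a field and let $\mathscr C$ be a $\operatorname{Hom}$-finite $k$-linear abelian category having a canonical bimodule $\omega_{\mathscr C}$ and an ample sequence $\{E_i\}_{i\in\mathbb Z}$ which is a full geometric helix of some period $\ell$ for $\mathscr D^b(\mathscr C)$. Then the following are equivalent: (1) $C:=C(\mathscr C,\{E_i\}_{i\in\mathbb Z})_{\ge0}$ is right noetherian. (2) $\mathscr C$ is a noetherian category (every object is noetherian). (3) $E_i\in\mathscr C$ is a noetherian object for every $i\in\mathbb Z$.
   Context: $D(-)=\operatorname{Hom}_k(-,k)$. A $\mathbb Z$-algebra is a $k$-algebra $C=\bigoplus_{i,j\in\mathbb Z}C_{ij}$ (without global unity) with $C_{ij}C_{jt}\subset C_{it}$, $C_{ij}C_{st}=0$ if $j\ne s$, such that each $C_{ii}$ has a unity $e_i$ with $e_iae_j=a$ for all $a\in C_{ij}$. A graded right $C$-module is $M=\bigoplus_jM_j$ with action $M_i\otimes C_{ij}\to M_j$, $e_i$ acting as the identity on $M_i$; $\operatorname{GrMod}C$ is their category, with degree-preserving homomorphisms. $C$ is right noetherian if $P_i=e_iC=\bigoplus_jC_{ij}$ is a noetherian object of $\operatorname{GrMod}C$ for every $i$. $C(\mathscr C,\{E_i\})$ is the $\mathbb Z$-algebra with $(i,j)$ component $\operatorname{Hom}_{\mathscr C}(E_{-j},E_{-i})$ and multiplication given by composition; $C_{\ge0}=\bigoplus_{j-i\ge0}C_{ij}$. A Serre functor is a $k$-linear autoequivalence $S$ with bifunctorial isomorphisms $\operatorname{Hom}(X,Y)\cong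 D\operatorname{Hom}(Y,S(X))$. A bimodule over $\mathscr C$ is an adjoint pair $\mathcal L=(-\otimes_{\mathscr C}\mathcal L,\mathcal Hom_{\mathscr C}(\mathcal L,-))$ of endofunctors of $\mathscr C$; it is invertible if $-\otimes_{\mathscr C}\mathcal L$ is an autoequivalence, and then $-\otimes_{\mathscr C}\mathcal L^{-1}=\mathcal Hom_{\mathscr C}(\mathcal L,-)$. A canonical bimodule is an invertible bimodule $\omega_{\mathscr C}$ such that for some $n\in\mathbb Z$ the induced autoequivalence $-\otimes^{\mathbf L}_{\mathscr C}\omega_{\mathscr C}[n]$ of $\mathscr D^b(\mathscr C)$ is a Serre functor. $\{E_i\}_{i\in\mathbb Z}$ in $\mathscr C$ is ample if (A1) for every $X\in\mathscr C$ and $m\in\mathbb Z$ there is a surjection $\bigoplus_{j=1}^sE_{-i_j}\to X$ with $i_1,\dots,i_s\ge m$; and (A2) for every surjection $X\to Y$ there is $m$ such that $\operatorname{Hom}(E_{-i},X)\to\operatorname{Hom}(E_{-i},Y)$ is surjective for all $i\ge m$. With $\operatorname{Ext}^q_{\mathscr C}(X,Y)=\operatorname{Hom}_{\mathscr D^b(\mathscr C)}(X,Y[q])$, a sequence $\{E_i\}_{i\in\mathbb Z}$ in $\mathscr D^b(\mathscr C)$ is a helix of period $\ell$ if (H1) $E_{i+\ell}\cong E_i\otimes^{\mathbf L}_{\mathscr C}\omega_{\mathscr C}^{-1}$ for all $i$; (H2) $\operatorname{Ext}^0(E_i,E_i)\cong k$ and $\operatorname{Ext}^q(E_i,E_i)=0$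 for $q\ne0$; (H3) $\operatorname{Ext}^q(E_i,E_j)=0$ for all $q$ and all $0<i-j<\ell$. It is geometric if $\operatorname{Ext}^q(E_i,E_j)=0$ for all $q\ne0$, $i\le j$; full if for every $i$ the smallest full triangulated subcategory of $\mathscr D^b(\mathscr C)$ containing $E_i,\dots,E_{i+\ell-1}$, closed under isomorphisms and direct summands, is $\mathscr D^b(\mathscr C)$. *)

theory Defs
  imports "Jordan_Normal_Form.Missing_VectorSpace"
begin

section \<open>Vector spaces\<close>

text \<open>Vector spaces over a field \<open>k\<close> are records of type \<open>module\<close> satisfying the locale
  \<open>vectorspace k\<close>; the ring fields \<open>mult\<close> and \<open>one\<close> of such records are never used.\<close>

definition field_space :: "('k, 'r) ring_scheme \<Rightarrow> ('k, 'k) module" where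
  "field_space k = \<lparr>carrier = carrier k, mult = undefined, one = undefined,
     zero = \<zero>\<^bsub>k\<^esub>, add = add k, smult = mult k\<rparr>"

definition dual_space :: "('k, 'r) ring_scheme \<Rightarrow> ('k, 'v, 's) module_scheme \<Rightarrow> ('k, 'v \<Rightarrow> 'k) module" where
  "dual_space k V = \<lparr>carrier = module_hom k V (field_space k) \<inter> extensional (carrier V),
     mult = undefined, one = undefined,
     zero = (\<lambda>v\<in>carrier V. \<zero>\<^bsub>k\<^esub>),
     add = (\<lambda>f g. \<lambda>v\<in>carrier V. f v \<oplus>\<^bsub>k\<^esub> g v),
     smult = (\<lambda>c f. \<lambda>v\<in>carrier V. c \<otimes>\<^bsub>k\<^esub> f v)\<rparr>"

definition linear_iso ::
  "('k, 'r) ring_scheme \<Rightarrow> ('k, 'v, 's) module_scheme \<Rightarrow> ('k, 'w, 't) module_scheme \<Rightarrow> ('v \<Rightarrow> 'w) \<Rightarrow> bool" where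
  "linear_iso k V W f \<longleftrightarrow> f \<in> module_hom k V W \<and> bij_betw f (carrier V) (carrier W)"

definition zero_space :: "('k, 'v, 's) module_scheme \<Rightarrow> bool" where
  "zero_space V \<longleftrightarrow> carrier V = {\<zero>\<^bsub>V\<^esub>}"


section \<open>Categories\<close>

record ('o, 'm) category =
  Obj :: "'o set"
  Hom :: "'o \<Rightarrow> 'o \<Rightarrow> 'm set"
  Id :: "'o \<Rightarrow> 'm"
  cmp :: "'m \<Rightarrow> 'm \<Rightarrow> 'm" (infixl \<open>\<cdot>\<index>\<close> 70)

text \<open>\<open>g \<cdot> f\<close> is ``first \<open>f\<close>, then \<open>g\<close>''. As usual, a morphism determines its source and target.\<close>

locale category =
  fixes C :: "('o, 'm, 'z) category_scheme" (structure)
  assumes Id_closed: "X \<in> Obj C \<Longrightarrow> Id C X \<in> Hom C X X"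
    and cmp_closed: "\<lbrakk>X \<in> Obj C; Y \<in> Obj C; Z \<in> Obj C; f \<in> Hom C X Y; g \<in> Hom C Y Z\<rbrakk>
      \<Longrightarrow> g \<cdot> f \<in> Hom C X Z"
    and Id_left: "\<lbrakk>X \<in> Obj C; Y \<in> Obj C; f \<in> Hom C X Y\<rbrakk> \<Longrightarrow> Id C Y \<cdot> f = f"
    and Id_right: "\<lbrakk>X \<in> Obj C; Y \<in> Obj C; f \<in> Hom C X Y\<rbrakk> \<Longrightarrow> f \<cdot> Id C X = f"
    and cmp_assoc: "\<lbrakk>W \<in> Obj C; X \<in> Obj C; Y \<in> Obj C; Z \<in> Obj C;
        f \<in> Hom C W X; g \<in> Hom C X Y; h \<in> Hom C Y Z\<rbrakk> \<Longrightarrow> (h \<cdot> g) \<cdot> f = h \<cdot> (g \<cdot> f)"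
    and Hom_disjoint: "\<lbrakk>X \<in> Obj C; Y \<in> Obj C; X' \<in> Obj C; Y' \<in> Obj C;
        f \<in> Hom C X Y; f \<in> Hom C X' Y'\<rbrakk> \<Longrightarrow> X = X' \<and> Y = Y'"

definition is_mono :: "('o, 'm, 'z) category_scheme \<Rightarrow> 'o \<Rightarrow> 'o \<Rightarrow> 'm \<Rightarrow> bool" where
  "is_mono C X Y f \<longleftrightarrow> f \<in> Hom C X Y \<and>
     (\<forall>W\<in>Obj C. \<forall>g\<in>Hom C W X. \<forall>h\<in>Hom C W X. f \<cdot>\<^bsub>C\<^esub> g = f \<cdot>\<^bsub>C\<^esub> h \<longrightarrow> g = h)"

definition is_epi :: "('o, 'm, 'z) category_scheme \<Rightarrow> 'o \<Rightarrow> 'o \<Rightarrow> 'm \<Rightarrow> bool" where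
  "is_epi C X Y f \<longleftrightarrow> f \<in> Hom C X Y \<and>
     (\<forall>W\<in>Obj C. \<forall>g\<in>Hom C Y W. \<forall>h\<in>Hom C Y W. g \<cdot>\<^bsub>C\<^esub> f = h \<cdot>\<^bsub>C\<^esub> f \<longrightarrow> g = h)"

definition is_iso :: "('o, 'm, 'z) category_scheme \<Rightarrow> 'o \<Rightarrow> 'o \<Rightarrow> 'm \<Rightarrow> bool" where
  "is_iso C X Y f \<longleftrightarrow> f \<in> Hom C X Y \<and>
     (\<exists>g\<in>Hom C Y X. g \<cdot>\<^bsub>C\<^esub> f = Id C X \<and> f \<cdot>\<^bsub>C\<^esub> g = Id C Y)"

definition isomorphic :: "('o, 'm, 'z) category_scheme \<Rightarrow> 'o \<Rightarrow> 'o \<Rightarrow> bool" where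
  "isomorphic C X Y \<longleftrightarrow> (\<exists>f. is_iso C X Y f)"

text \<open>Subobjects are represented by monomorphisms, preordered by factorisation.\<close>

definition subobject_le :: "('o, 'm, 'z) category_scheme \<Rightarrow> 'o \<Rightarrow> 'm \<Rightarrow> 'o \<Rightarrow> 'm \<Rightarrow> bool" where
  "subobject_le C S m S' m' \<longleftrightarrow> (\<exists>h\<in>Hom C S S'. m' \<cdot>\<^bsub>C\<^esub> h = m)"

definition noetherian_object :: "('o, 'm, 'z) category_scheme \<Rightarrow> 'o \<Rightarrow> bool" where
  "noetherian_object C X \<longleftrightarrow> X \<in> Obj C \<and>
     (\<forall>S m. (\<forall>n::nat. S n \<in> Obj C \<and> is_mono C (S n) X (m n)) \<and>
            (\<forall>n. subobject_le C (S n) (m n) (S (Suc n)) (m (Suc n)))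
        \<longrightarrow> (\<exists>N. \<forall>n\<ge>N. subobject_le C (S n) (m n) (S N) (m N)))"

definition noetherian_category :: "('o, 'm, 'z) category_scheme \<Rightarrow> bool" where
  "noetherian_category C \<longleftrightarrow> (\<forall>X\<in>Obj C. noetherian_object C X)"

definition is_zero_object :: "('o, 'm, 'z) category_scheme \<Rightarrow> 'o \<Rightarrow> bool" where
  "is_zero_object C Z \<longleftrightarrow> Z \<in> Obj C \<and> (\<forall>X\<in>Obj C. (\<exists>!f. f \<in> Hom C X Z) \<and> (\<exists>!f. f \<in> Hom C Z X))"

definition is_coproduct :: "('o, 'm, 'z) category_scheme \<Rightarrow> 'o list \<Rightarrow> 'o \<Rightarrow> (nat \<Rightarrow> 'm) \<Rightarrow> bool" where
  "is_coproduct C Xs S \<iota> \<longleftrightarrow> S \<in> Obj C \<and> (\<forall>j<length Xs. \<iota> j \<in> Hom C (Xs ! j) S) \<and>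
     (\<forall>W\<in>Obj C. \<forall>g. (\<forall>j<length Xs. g j \<in> Hom C (Xs ! j) W)
        \<longrightarrow> (\<exists>!h. h \<in> Hom C S W \<and> (\<forall>j<length Xs. h \<cdot>\<^bsub>C\<^esub> \<iota> j = g j)))"


section \<open>Functors\<close>

record ('o, 'm, 'p, 'n) funct =
  omap :: "'o \<Rightarrow> 'p"
  mmap :: "'m \<Rightarrow> 'n"

definition is_functor ::
  "('o, 'm, 'y) category_scheme \<Rightarrow> ('p, 'n, 'z) category_scheme \<Rightarrow> ('o, 'm, 'p, 'n) funct \<Rightarrow> bool" where
  "is_functor C D F \<longleftrightarrow>
     (\<forall>X\<in>Obj C. omap F X \<in> Obj D \<and> mmap F (Id C X) = Id D (omap F X)) \<and>
     (\<forall>X\<in>Obj C. \<forall>Y\<in>Obj C. \<forall>f\<in>Hom C X Y. mmap F f \<in> Hom D (omap F X) (omap F Y)) \<and>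
     (\<forall>X\<in>Obj C. \<forall>Y\<in>Obj C. \<forall>Z\<in>Obj C. \<forall>f\<in>Hom C X Y. \<forall>g\<in>Hom C Y Z.
        mmap F (g \<cdot>\<^bsub>C\<^esub> f) = mmap F g \<cdot>\<^bsub>D\<^esub> mmap F f)"

definition id_funct :: "('o, 'm, 'o, 'm) funct" where
  "id_funct = \<lparr>omap = id, mmap = id\<rparr>"

definition comp_funct ::
  "('p, 'n, 'q, 'l) funct \<Rightarrow> ('o, 'm, 'p, 'n) funct \<Rightarrow> ('o, 'm, 'q, 'l) funct" where
  "comp_funct G F = \<lparr>omap = omap G \<circ> omap F, mmap = mmap G \<circ> mmap F\<rparr>"

definition natural_iso ::
  "('o, 'm, 'y) category_scheme \<Rightarrow> ('p, 'n, 'z) category_scheme \<Rightarrow>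
   ('o, 'm, 'p, 'n) funct \<Rightarrow> ('o, 'm, 'p, 'n) funct \<Rightarrow> ('o \<Rightarrow> 'n) \<Rightarrow> bool" where
  "natural_iso C D F G \<eta> \<longleftrightarrow>
     (\<forall>X\<in>Obj C. is_iso D (omap F X) (omap G X) (\<eta> X)) \<and>
     (\<forall>X\<in>Obj C. \<forall>Y\<in>Obj C. \<forall>f\<in>Hom C X Y. mmap G f \<cdot>\<^bsub>D\<^esub> \<eta> X = \<eta> Y \<cdot>\<^bsub>D\<^esub> mmap F f)"

definition autoequivalence :: "('o, 'm, 'z) category_scheme \<Rightarrow> ('o, 'm, 'o, 'm) funct \<Rightarrow> bool" where
  "autoequivalence C F \<longleftrightarrow> is_functor C C F \<and>
     (\<exists>G. is_functor C C G \<and>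
        (\<exists>\<eta>. natural_iso C C id_funct (comp_funct G F) \<eta>) \<and>
        (\<exists>\<epsilon>. natural_iso C C (comp_funct F G) id_funct \<epsilon>))"

definition is_adjunction ::
  "('o, 'm, 'y) category_scheme \<Rightarrow> ('p, 'n, 'z) category_scheme \<Rightarrow>
   ('o, 'm, 'p, 'n) funct \<Rightarrow> ('p, 'n, 'o, 'm) funct \<Rightarrow> ('o \<Rightarrow> 'p \<Rightarrow> 'n \<Rightarrow> 'm) \<Rightarrow> bool" where
  "is_adjunction C D F G \<phi> \<longleftrightarrow>
     (\<forall>X\<in>Obj C. \<forall>Y\<in>Obj D. bij_betw (\<phi> X Y) (Hom D (omap F X) Y) (Hom C X (omap G Y))) \<and>
     (\<forall>X\<in>Obj C. \<forall>X'\<in>Obj C. \<forall>Y\<in>Obj D. \<forall>Y'\<in>Obj D.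
        \<forall>f\<in>Hom C X' X. \<forall>g\<in>Hom D Y Y'. \<forall>h\<in>Hom D (omap F X) Y.
          \<phi> X' Y' (g \<cdot>\<^bsub>D\<^esub> (h \<cdot>\<^bsub>D\<^esub> mmap F f)) = mmap G g \<cdot>\<^bsub>C\<^esub> (\<phi> X Y h \<cdot>\<^bsub>C\<^esub> f))"


section \<open>Linear and abelian categories\<close>

record ('o, 'm, 'k) lin_category = "('o, 'm) category" +
  zero_mor :: "'o \<Rightarrow> 'o \<Rightarrow> 'm"
  add_mor :: "'m \<Rightarrow> 'm \<Rightarrow> 'm"
  smul_mor :: "'k \<Rightarrow> 'm \<Rightarrow> 'm"

definition hom_space :: "('o, 'm, 'k, 'z) lin_category_scheme \<Rightarrow> 'o \<Rightarrow> 'o \<Rightarrow> ('k, 'm) module" where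
  "hom_space C X Y = \<lparr>carrier = Hom C X Y, mult = undefined, one = undefined,
     zero = zero_mor C X Y, add = add_mor C, smult = smul_mor C\<rparr>"

locale linear_category = category C + field k
  for k :: "('k, 'r) ring_scheme" and C :: "('o, 'm, 'k, 'z) lin_category_scheme" (structure) +
  assumes hom_vectorspace: "\<lbrakk>X \<in> Obj C; Y \<in> Obj C\<rbrakk> \<Longrightarrow> vectorspace k (hom_space C X Y)"
    and cmp_linear_left: "\<lbrakk>X \<in> Obj C; Y \<in> Obj C; Z \<in> Obj C; f \<in> Hom C X Y\<rbrakk>
      \<Longrightarrow> (\<lambda>g. g \<cdot> f) \<in> module_hom k (hom_space C Y Z) (hom_space C X Z)"
    and cmp_linear_right: "\<lbrakk>X \<in> Obj C; Y \<in> Obj C; Z \<in> Obj C; g \<in> Hom C Y Z\<rbrakk>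
      \<Longrightarrow> (\<lambda>f. g \<cdot> f) \<in> module_hom k (hom_space C X Y) (hom_space C X Z)"

definition is_biproduct ::
  "('o, 'm, 'k, 'z) lin_category_scheme \<Rightarrow> 'o \<Rightarrow> 'o \<Rightarrow> 'o \<Rightarrow> 'm \<Rightarrow> 'm \<Rightarrow> 'm \<Rightarrow> 'm \<Rightarrow> bool" where
  "is_biproduct C X Y B i1 i2 p1 p2 \<longleftrightarrow> B \<in> Obj C \<and>
     i1 \<in> Hom C X B \<and> i2 \<in> Hom C Y B \<and> p1 \<in> Hom C B X \<and> p2 \<in> Hom C B Y \<and>
     p1 \<cdot>\<^bsub>C\<^esub> i1 = Id C X \<and> p2 \<cdot>\<^bsub>C\<^esub> i2 = Id C Y \<and>
     p1 \<cdot>\<^bsub>C\<^esub> i2 = zero_mor C Y X \<and> p2 \<cdot>\<^bsub>C\<^esub> i1 = zero_mor C X Y \<and>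
     add_mor C (i1 \<cdot>\<^bsub>C\<^esub> p1) (i2 \<cdot>\<^bsub>C\<^esub> p2) = Id C B"

definition is_kernel ::
  "('o, 'm, 'k, 'z) lin_category_scheme \<Rightarrow> 'o \<Rightarrow> 'o \<Rightarrow> 'm \<Rightarrow> 'o \<Rightarrow> 'm \<Rightarrow> bool" where
  "is_kernel C X Y f K \<kappa> \<longleftrightarrow> K \<in> Obj C \<and> \<kappa> \<in> Hom C K X \<and> f \<cdot>\<^bsub>C\<^esub> \<kappa> = zero_mor C K Y \<and>
     (\<forall>W\<in>Obj C. \<forall>g\<in>Hom C W X. f \<cdot>\<^bsub>C\<^esub> g = zero_mor C W Y
        \<longrightarrow> (\<exists>!h. h \<in> Hom C W K \<and> \<kappa> \<cdot>\<^bsub>C\<^esub> h = g))"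

definition is_cokernel ::
  "('o, 'm, 'k, 'z) lin_category_scheme \<Rightarrow> 'o \<Rightarrow> 'o \<Rightarrow> 'm \<Rightarrow> 'o \<Rightarrow> 'm \<Rightarrow> bool" where
  "is_cokernel C X Y f Q \<pi> \<longleftrightarrow> Q \<in> Obj C \<and> \<pi> \<in> Hom C Y Q \<and> \<pi> \<cdot>\<^bsub>C\<^esub> f = zero_mor C X Q \<and>
     (\<forall>W\<in>Obj C. \<forall>g\<in>Hom C Y W. g \<cdot>\<^bsub>C\<^esub> f = zero_mor C X W
        \<longrightarrow> (\<exists>!h. h \<in> Hom C Q W \<and> h \<cdot>\<^bsub>C\<^esub> \<pi> = g))"

locale abelian_category = linear_category k C
  for k :: "('k, 'r) ring_scheme" and C :: "('o, 'm, 'k, 'z) lin_category_scheme" (structure) +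
  assumes zero_object_exists: "\<exists>Z. is_zero_object C Z"
    and biproduct_exists: "\<lbrakk>X \<in> Obj C; Y \<in> Obj C\<rbrakk> \<Longrightarrow> \<exists>B i1 i2 p1 p2. is_biproduct C X Y B i1 i2 p1 p2"
    and kernel_exists: "\<lbrakk>X \<in> Obj C; Y \<in> Obj C; f \<in> Hom C X Y\<rbrakk> \<Longrightarrow> \<exists>K \<kappa>. is_kernel C X Y f K \<kappa>"
    and cokernel_exists: "\<lbrakk>X \<in> Obj C; Y \<in> Obj C; f \<in> Hom C X Y\<rbrakk> \<Longrightarrow> \<exists>Q \<pi>. is_cokernel C X Y f Q \<pi>"
    and mono_is_kernel: "\<lbrakk>X \<in> Obj C; Y \<in> Obj C; is_mono C X Y f\<rbrakk>
      \<Longrightarrow> \<exists>Z\<in>Obj C. \<exists>g\<in>Hom C Y Z. is_kernel C Y Z g X f"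
    and epi_is_cokernel: "\<lbrakk>X \<in> Obj C; Y \<in> Obj C; is_epi C X Y f\<rbrakk>
      \<Longrightarrow> \<exists>W\<in>Obj C. \<exists>g\<in>Hom C W X. is_cokernel C W X g Y f"

definition hom_finite :: "('k, 'r) ring_scheme \<Rightarrow> ('o, 'm, 'k, 'z) lin_category_scheme \<Rightarrow> bool" where
  "hom_finite k C \<longleftrightarrow> (\<forall>X\<in>Obj C. \<forall>Y\<in>Obj C. vectorspace.fin_dim k (hom_space C X Y))"

definition linear_functor ::
  "('k, 'r) ring_scheme \<Rightarrow> ('o, 'm, 'k, 'y) lin_category_scheme \<Rightarrow> ('p, 'n, 'k, 'z) lin_category_scheme \<Rightarrow>
   ('o, 'm, 'p, 'n) funct \<Rightarrow> bool" where
  "linear_functor k C D F \<longleftrightarrow> is_functor C D F \<and>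
     (\<forall>X\<in>Obj C. \<forall>Y\<in>Obj C. mmap F \<in> module_hom k (hom_space C X Y) (hom_space D (omap F X) (omap F Y)))"

text \<open>Naturality of \<open>\<eta>\<close> is read off from \<open>D Hom(Y, S X)\<close>: for \<open>f : X' \<rightarrow> X\<close> and \<open>g : Y \<rightarrow> Y'\<close> the
  induced map sends a functional \<open>\<theta>\<close> on \<open>Hom(Y, S X)\<close> to \<open>u \<mapsto> \<theta> (S f \<cdot> u \<cdot> g)\<close> on \<open>Hom(Y', S X')\<close>.\<close>

definition serre_functor ::
  "('k, 'r) ring_scheme \<Rightarrow> ('o, 'm, 'k, 'z) lin_category_scheme \<Rightarrow> ('o, 'm, 'o, 'm) funct \<Rightarrow> bool" where
  "serre_functor k C S \<longleftrightarrow> linear_functor k C C S \<and> autoequivalence C S \<and>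
     (\<exists>\<eta>. (\<forall>X\<in>Obj C. \<forall>Y\<in>Obj C.
              linear_iso k (hom_space C X Y) (dual_space k (hom_space C Y (omap S X))) (\<eta> X Y)) \<and>
          (\<forall>X\<in>Obj C. \<forall>X'\<in>Obj C. \<forall>Y\<in>Obj C. \<forall>Y'\<in>Obj C.
             \<forall>f\<in>Hom C X' X. \<forall>g\<in>Hom C Y Y'. \<forall>h\<in>Hom C X Y. \<forall>u\<in>Hom C Y' (omap S X').
               \<eta> X' Y' (g \<cdot>\<^bsub>C\<^esub> (h \<cdot>\<^bsub>C\<^esub> f)) u = \<eta> X Y h (mmap S f \<cdot>\<^bsub>C\<^esub> (u \<cdot>\<^bsub>C\<^esub> g))))"


section \<open>Bounded cochain complexes\<close>

record ('o, 'm) cochain =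
  cob :: "int \<Rightarrow> 'o"
  cdiff :: "int \<Rightarrow> 'm"

record ('o, 'm) chain_map =
  csrc :: "('o, 'm) cochain"
  ctgt :: "('o, 'm) cochain"
  cmap :: "int \<Rightarrow> 'm"

definition bounded_complexes :: "('o, 'm, 'k, 'z) lin_category_scheme \<Rightarrow> ('o, 'm) cochain set" where
  "bounded_complexes C = {X.
     (\<forall>n. cob X n \<in> Obj C \<and> cdiff X n \<in> Hom C (cob X n) (cob X (n + 1)) \<and>
          cdiff X (n + 1) \<cdot>\<^bsub>C\<^esub> cdiff X n = zero_mor C (cob X n) (cob X (n + 1 + 1))) \<and>
     (\<exists>N. \<forall>n. \<bar>n\<bar> > N \<longrightarrow> is_zero_object C (cob X n))}"

definition chain_maps ::
  "('o, 'm, 'k, 'z) lin_category_scheme \<Rightarrow> ('o, 'm) cochain \<Rightarrow> ('o, 'm) cochain \<Rightarrow> ('o, 'm) chain_map set" where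
  "chain_maps C X Y = {f. csrc f = X \<and> ctgt f = Y \<and>
     (\<forall>n. cmap f n \<in> Hom C (cob X n) (cob Y n) \<and>
          cdiff Y n \<cdot>\<^bsub>C\<^esub> cmap f n = cmap f (n + 1) \<cdot>\<^bsub>C\<^esub> cdiff X n)}"

definition Cb :: "('o, 'm, 'k, 'z) lin_category_scheme \<Rightarrow>
    (('o, 'm) cochain, ('o, 'm) chain_map, 'k) lin_category" where
  "Cb C = \<lparr>Obj = bounded_complexes C, Hom = chain_maps C,
     Id = (\<lambda>X. \<lparr>csrc = X, ctgt = X, cmap = \<lambda>n. Id C (cob X n)\<rparr>),
     cmp = (\<lambda>g f. \<lparr>csrc = csrc f, ctgt = ctgt g, cmap = \<lambda>n. cmap g n \<cdot>\<^bsub>C\<^esub> cmap f n\<rparr>),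
     zero_mor = (\<lambda>X Y. \<lparr>csrc = X, ctgt = Y, cmap = \<lambda>n. zero_mor C (cob X n) (cob Y n)\<rparr>),
     add_mor = (\<lambda>f g. \<lparr>csrc = csrc f, ctgt = ctgt f, cmap = \<lambda>n. add_mor C (cmap f n) (cmap g n)\<rparr>),
     smul_mor = (\<lambda>c f. \<lparr>csrc = csrc f, ctgt = ctgt f, cmap = \<lambda>n. smul_mor C c (cmap f n)\<rparr>)\<rparr>"

definition homotopic ::
  "('o, 'm, 'k, 'z) lin_category_scheme \<Rightarrow> ('o, 'm) chain_map \<Rightarrow> ('o, 'm) chain_map \<Rightarrow> bool" where
  "homotopic C f g \<longleftrightarrow> (\<exists>X\<in>bounded_complexes C. \<exists>Y\<in>bounded_complexes C.
     f \<in> chain_maps C X Y \<and> g \<in> chain_maps C X Y \<and>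
     (\<exists>s. \<forall>n. s n \<in> Hom C (cob X n) (cob Y (n - 1)) \<and>
        cmap f n = add_mor C (cmap g n)
          (add_mor C (cdiff Y (n - 1) \<cdot>\<^bsub>C\<^esub> s n) (s (n + 1) \<cdot>\<^bsub>C\<^esub> cdiff X n))))"

text \<open>\<open>H = H\<^sup>n(X)\<close> is the cokernel \<open>p\<close> of the corestriction \<open>b\<close> of the differential to the
  kernel \<open>z : Z \<rightarrow> X\<^sup>n\<close> of the next one.\<close>

definition is_cohomology ::
  "('o, 'm, 'k, 'z) lin_category_scheme \<Rightarrow> ('o, 'm) cochain \<Rightarrow> int \<Rightarrow> 'o \<Rightarrow> 'm \<Rightarrow> 'm \<Rightarrow> 'o \<Rightarrow> 'm \<Rightarrow> bool" where
  "is_cohomology C X n Z z b H p \<longleftrightarrow>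
     is_kernel C (cob X n) (cob X (n + 1)) (cdiff X n) Z z \<and>
     b \<in> Hom C (cob X (n - 1)) Z \<and> z \<cdot>\<^bsub>C\<^esub> b = cdiff X (n - 1) \<and>
     is_cokernel C (cob X (n - 1)) Z b H p"

text \<open>\<open>\<psi>\<close> below is the map on cohomology induced by \<open>f\<close>. The choices exist, and are unique up to
  unique isomorphism, in an abelian category.\<close>

definition quasi_iso :: "('o, 'm, 'k, 'z) lin_category_scheme \<Rightarrow> ('o, 'm) chain_map \<Rightarrow> bool" where
  "quasi_iso C f \<longleftrightarrow> (\<forall>n Z z b H p Z' z' b' H' p' \<phi> \<psi>.
     is_cohomology C (csrc f) n Z z b H p \<longrightarrow>
     is_cohomology C (ctgt f) n Z' z' b' H' p' \<longrightarrow>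
     \<phi> \<in> Hom C Z Z' \<longrightarrow> z' \<cdot>\<^bsub>C\<^esub> \<phi> = cmap f n \<cdot>\<^bsub>C\<^esub> z \<longrightarrow>
     \<psi> \<in> Hom C H H' \<longrightarrow> \<psi> \<cdot>\<^bsub>C\<^esub> p = p' \<cdot>\<^bsub>C\<^esub> \<phi> \<longrightarrow>
     is_iso C H H' \<psi>)"

definition stalk :: "('o, 'm, 'k, 'z) lin_category_scheme \<Rightarrow> 'o \<Rightarrow> ('o, 'm) cochain" where
  "stalk C X = (let c = (\<lambda>n::int. if n = 0 then X else (SOME Z. is_zero_object C Z))
     in \<lparr>cob = c, cdiff = \<lambda>n. zero_mor C (c n) (c (n + 1))\<rparr>)"

text \<open>\<open>X[q]\<^sup>n = X\<^sup>(\<^sup>n\<^sup>+\<^sup>q\<^sup>)\<close> with differential multiplied by \<open>(-1)\<^sup>q\<close>.\<close>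

definition shift :: "('o, 'm, 'k, 'z) lin_category_scheme \<Rightarrow> int \<Rightarrow> ('o, 'm) cochain \<Rightarrow> ('o, 'm) cochain" where
  "shift C q X = \<lparr>cob = \<lambda>n. cob X (n + q),
     cdiff = \<lambda>n. if even q then cdiff X (n + q)
       else \<ominus>\<^bsub>hom_space C (cob X (n + q)) (cob X (n + 1 + q))\<^esub> cdiff X (n + q)\<rparr>"

definition shift_map ::
  "('o, 'm, 'k, 'z) lin_category_scheme \<Rightarrow> int \<Rightarrow> ('o, 'm) chain_map \<Rightarrow> ('o, 'm) chain_map" where
  "shift_map C q f = \<lparr>csrc = shift C q (csrc f), ctgt = shift C q (ctgt f), cmap = \<lambda>n. cmap f (n + q)\<rparr>"

definition apply_cochain :: "('o, 'm, 'o, 'm) funct \<Rightarrow> ('o, 'm) cochain \<Rightarrow> ('o, 'm) cochain" where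
  "apply_cochain F X = \<lparr>cob = \<lambda>n. omap F (cob X n), cdiff = \<lambda>n. mmap F (cdiff X n)\<rparr>"

definition apply_chain_map :: "('o, 'm, 'o, 'm) funct \<Rightarrow> ('o, 'm) chain_map \<Rightarrow> ('o, 'm) chain_map" where
  "apply_chain_map F f = \<lparr>csrc = apply_cochain F (csrc f), ctgt = apply_cochain F (ctgt f),
     cmap = \<lambda>n. mmap F (cmap f n)\<rparr>"

text \<open>\<open>K\<close> is a mapping cone of \<open>f : X \<rightarrow> Y\<close>, i.e. \<open>K\<^sup>n = X\<^sup>(\<^sup>n\<^sup>+\<^sup>1\<^sup>) \<oplus> Y\<^sup>n\<close> with differential
  \<open>(x, y) \<mapsto> (- d x, f x + d y)\<close>, with inclusion \<open>i : Y \<rightarrow> K\<close> and projection \<open>\<pi> : K \<rightarrow> X[1]\<close>.\<close>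

definition is_mapping_cone ::
  "('o, 'm, 'k, 'z) lin_category_scheme \<Rightarrow> ('o, 'm) cochain \<Rightarrow> ('o, 'm) cochain \<Rightarrow> ('o, 'm) chain_map \<Rightarrow>
   ('o, 'm) cochain \<Rightarrow> ('o, 'm) chain_map \<Rightarrow> ('o, 'm) chain_map \<Rightarrow> bool" where
  "is_mapping_cone C X Y f K i \<pi> \<longleftrightarrow>
     K \<in> bounded_complexes C \<and> f \<in> chain_maps C X Y \<and>
     i \<in> chain_maps C Y K \<and> \<pi> \<in> chain_maps C K (shift C 1 X) \<and>
     (\<exists>j r. (\<forall>n. is_biproduct C (cob X (n + 1)) (cob Y n) (cob K n) (j n) (cmap i n) (cmap \<pi> n) (r n)) \<and>
        (\<forall>n. cdiff K n =
           add_mor C (j (n + 1) \<cdot>\<^bsub>C\<^esub> (cdiff (shift C 1 X) n \<cdot>\<^bsub>C\<^esub> cmap \<pi> n))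
             (cmap i (n + 1) \<cdot>\<^bsub>C\<^esub>
               add_mor C (cmap f (n + 1) \<cdot>\<^bsub>C\<^esub> cmap \<pi> n) (cdiff Y n \<cdot>\<^bsub>C\<^esub> r n))))"


section \<open>The bounded derived category\<close>

text \<open>\<open>Db C\<close> is the localisation of the homotopy category of bounded complexes at the
  quasi-isomorphisms. A morphism \<open>X \<rightarrow> Y\<close> is an equivalence class of roofs \<open>(s, f)\<close>, standing for
  \<open>X \<leftarrow> Z \<rightarrow> Y\<close> with \<open>s : Z \<rightarrow> X\<close> a quasi-isomorphism and \<open>f : Z \<rightarrow> Y\<close>.\<close>

type_synonym ('o, 'm) roof = "('o, 'm) chain_map \<times> ('o, 'm) chain_map"

definition roofs :: "('o, 'm, 'k, 'z) lin_category_scheme \<Rightarrow> ('o, 'm) cochain \<Rightarrow> ('o, 'm) cochain \<Rightarrow>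
    ('o, 'm) roof set" where
  "roofs C X Y = {(s, f). \<exists>Z\<in>bounded_complexes C. s \<in> chain_maps C Z X \<and> quasi_iso C s \<and> f \<in> chain_maps C Z Y}"

definition roof_rel :: "('o, 'm, 'k, 'z) lin_category_scheme \<Rightarrow> ('o, 'm) cochain \<Rightarrow> ('o, 'm) cochain \<Rightarrow>
    ('o, 'm) roof rel" where
  "roof_rel C X Y = {((s, f), (t, g)). (s, f) \<in> roofs C X Y \<and> (t, g) \<in> roofs C X Y \<and>
     (\<exists>W\<in>bounded_complexes C. \<exists>u\<in>chain_maps C W (csrc s). \<exists>v\<in>chain_maps C W (csrc t).
        quasi_iso C (s \<cdot>\<^bsub>Cb C\<^esub> u) \<and>
        homotopic C (s \<cdot>\<^bsub>Cb C\<^esub> u) (t \<cdot>\<^bsub>Cb C\<^esub> v) \<and> homotopic C (f \<cdot>\<^bsub>Cb C\<^esub> u) (g \<cdot>\<^bsub>Cb C\<^esub> v))}"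

definition roof_class :: "('o, 'm, 'k, 'z) lin_category_scheme \<Rightarrow> ('o, 'm) roof \<Rightarrow> ('o, 'm) roof set" where
  "roof_class C r = roof_rel C (ctgt (fst r)) (ctgt (snd r)) `` {r}"

text \<open>The operations on classes are given by the usual formulas on representatives; the union runs
  over all admissible choices, which all yield the same class. Addition uses a common denominator,
  composition of \<open>(t, g)\<close> after \<open>(s, f)\<close> completes \<open>f\<close> and \<open>t\<close> to a square commuting up to
  homotopy.\<close>

definition Db_cmp :: "('o, 'm, 'k, 'z) lin_category_scheme \<Rightarrow>
    ('o, 'm) roof set \<Rightarrow> ('o, 'm) roof set \<Rightarrow> ('o, 'm) roof set" where
  "Db_cmp C \<beta> \<alpha> = \<Union> {roof_class C (s \<cdot>\<^bsub>Cb C\<^esub> t', g \<cdot>\<^bsub>Cb C\<^esub> f') | s f t g t' f' P.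
     (s, f) \<in> \<alpha> \<and> (t, g) \<in> \<beta> \<and> P \<in> bounded_complexes C \<and>
     t' \<in> chain_maps C P (csrc s) \<and> quasi_iso C t' \<and> f' \<in> chain_maps C P (csrc t) \<and>
     homotopic C (f \<cdot>\<^bsub>Cb C\<^esub> t') (t \<cdot>\<^bsub>Cb C\<^esub> f')}"

definition localise :: "('o, 'm, 'k, 'z) lin_category_scheme \<Rightarrow> ('o, 'm) chain_map \<Rightarrow> ('o, 'm) roof set" where
  "localise C f = roof_class C (Id (Cb C) (csrc f), f)"

definition Db :: "('o, 'm, 'k, 'z) lin_category_scheme \<Rightarrow>
    (('o, 'm) cochain, ('o, 'm) roof set, 'k) lin_category" where
  "Db C = \<lparr>Obj = bounded_complexes C,
     Hom = (\<lambda>X Y. roofs C X Y // roof_rel C X Y),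
     Id = (\<lambda>X. localise C (Id (Cb C) X)),
     cmp = Db_cmp C,
     zero_mor = (\<lambda>X Y. localise C (zero_mor (Cb C) X Y)),
     add_mor = (\<lambda>\<alpha> \<beta>. \<Union> {roof_class C (s, add_mor (Cb C) f g) | s f g. (s, f) \<in> \<alpha> \<and> (s, g) \<in> \<beta>}),
     smul_mor = (\<lambda>c \<alpha>. \<Union> {roof_class C (s, smul_mor (Cb C) c f) | s f. (s, f) \<in> \<alpha>})\<rparr>"

text \<open>The functor on \<open>Db C\<close> induced by an operation on complexes and chain maps that preserves
  quasi-isomorphisms.\<close>

definition Db_induced :: "('o, 'm, 'k, 'z) lin_category_scheme \<Rightarrow>
    (('o, 'm) cochain \<Rightarrow> ('o, 'm) cochain) \<Rightarrow> (('o, 'm) chain_map \<Rightarrow> ('o, 'm) chain_map) \<Rightarrow>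
    (('o, 'm) cochain, ('o, 'm) roof set, ('o, 'm) cochain, ('o, 'm) roof set) funct" where
  "Db_induced C \<Phi> \<Psi> = \<lparr>omap = \<Phi>,
     mmap = (\<lambda>\<alpha>. \<Union> {roof_class C (\<Psi> s, \<Psi> f) | s f. (s, f) \<in> \<alpha>})\<rparr>"

definition Db_shift :: "('o, 'm, 'k, 'z) lin_category_scheme \<Rightarrow> int \<Rightarrow>
    (('o, 'm) cochain, ('o, 'm) roof set, ('o, 'm) cochain, ('o, 'm) roof set) funct" where
  "Db_shift C q = Db_induced C (shift C q) (shift_map C q)"

text \<open>An autoequivalence of an abelian category is exact, so its derived functor is its
  termwise application.\<close>

definition Db_lift :: "('o, 'm, 'k, 'z) lin_category_scheme \<Rightarrow> ('o, 'm, 'o, 'm) funct \<Rightarrow>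
    (('o, 'm) cochain, ('o, 'm) roof set, ('o, 'm) cochain, ('o, 'm) roof set) funct" where
  "Db_lift C F = Db_induced C (apply_cochain F) (apply_chain_map F)"

definition Ext_space :: "('o, 'm, 'k, 'z) lin_category_scheme \<Rightarrow> int \<Rightarrow> ('o, 'm) cochain \<Rightarrow> ('o, 'm) cochain \<Rightarrow>
    ('k, ('o, 'm) roof set) module" where
  "Ext_space C q X Y = hom_space (Db C) X (omap (Db_shift C q) Y)"

definition distinguished_triangle :: "('o, 'm, 'k, 'z) lin_category_scheme \<Rightarrow>
    ('o, 'm) cochain \<Rightarrow> ('o, 'm) cochain \<Rightarrow> ('o, 'm) cochain \<Rightarrow>
    ('o, 'm) roof set \<Rightarrow> ('o, 'm) roof set \<Rightarrow> ('o, 'm) roof set \<Rightarrow> bool" where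
  "distinguished_triangle C X Y Z u v w \<longleftrightarrow>
     X \<in> Obj (Db C) \<and> Y \<in> Obj (Db C) \<and> Z \<in> Obj (Db C) \<and>
     u \<in> Hom (Db C) X Y \<and> v \<in> Hom (Db C) Y Z \<and> w \<in> Hom (Db C) Z (omap (Db_shift C 1) X) \<and>
     (\<exists>X'\<in>Obj (Db C). \<exists>Y'\<in>Obj (Db C). \<exists>f K i \<pi> a b c.
        is_mapping_cone C X' Y' f K i \<pi> \<and>
        is_iso (Db C) X X' a \<and> is_iso (Db C) Y Y' b \<and> is_iso (Db C) Z K c \<and>
        b \<cdot>\<^bsub>Db C\<^esub> u = localise C f \<cdot>\<^bsub>Db C\<^esub> a \<and>
        c \<cdot>\<^bsub>Db C\<^esub> v = localise C i \<cdot>\<^bsub>Db C\<^esub> b \<and>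
        mmap (Db_shift C 1) a \<cdot>\<^bsub>Db C\<^esub> w = localise C \<pi> \<cdot>\<^bsub>Db C\<^esub> c)"

text \<open>Full triangulated subcategories of \<open>Db C\<close>, identified with their sets of objects, that are
  closed under isomorphisms and direct summands.\<close>

definition thick_subcategory :: "('o, 'm, 'k, 'z) lin_category_scheme \<Rightarrow> ('o, 'm) cochain set \<Rightarrow> bool" where
  "thick_subcategory C T \<longleftrightarrow> T \<subseteq> Obj (Db C) \<and> T \<noteq> {} \<and>
     (\<forall>X\<in>T. omap (Db_shift C 1) X \<in> T \<and> omap (Db_shift C (-1)) X \<in> T) \<and>
     (\<forall>X Y Z u v w. distinguished_triangle C X Y Z u v w \<longrightarrow> X \<in> T \<longrightarrow> Y \<in> T \<longrightarrow> Z \<in> T) \<and>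
     (\<forall>X\<in>T. \<forall>Y\<in>Obj (Db C). isomorphic (Db C) X Y \<longrightarrow> Y \<in> T) \<and>
     (\<forall>X\<in>Obj (Db C). \<forall>Y\<in>Obj (Db C). \<forall>B\<in>T. \<forall>i1 i2 p1 p2.
        is_biproduct (Db C) X Y B i1 i2 p1 p2 \<longrightarrow> X \<in> T)"

definition thick_closure :: "('o, 'm, 'k, 'z) lin_category_scheme \<Rightarrow> ('o, 'm) cochain set \<Rightarrow> ('o, 'm) cochain set" where
  "thick_closure C A = \<Inter> {T. thick_subcategory C T \<and> A \<subseteq> T}"


section \<open>Canonical bimodules, ample sequences and helices\<close>

record ('o, 'm) bimodule =
  tensor_with :: "('o, 'm, 'o, 'm) funct"
  hom_from :: "('o, 'm, 'o, 'm) funct"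

definition is_bimodule :: "('o, 'm, 'z) category_scheme \<Rightarrow> ('o, 'm) bimodule \<Rightarrow> bool" where
  "is_bimodule C L \<longleftrightarrow> is_functor C C (tensor_with L) \<and> is_functor C C (hom_from L) \<and>
     (\<exists>\<phi>. is_adjunction C C (tensor_with L) (hom_from L) \<phi>)"

definition invertible_bimodule :: "('o, 'm, 'z) category_scheme \<Rightarrow> ('o, 'm) bimodule \<Rightarrow> bool" where
  "invertible_bimodule C L \<longleftrightarrow> is_bimodule C L \<and> autoequivalence C (tensor_with L)"

definition canonical_bimodule ::
  "('k, 'r) ring_scheme \<Rightarrow> ('o, 'm, 'k, 'z) lin_category_scheme \<Rightarrow> ('o, 'm) bimodule \<Rightarrow> bool" where
  "canonical_bimodule k C \<omega> \<longleftrightarrow> invertible_bimodule C \<omega> \<and>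
     (\<exists>n. serre_functor k (Db C) (comp_funct (Db_shift C n) (Db_lift C (tensor_with \<omega>))))"

definition ample :: "('o, 'm, 'z) category_scheme \<Rightarrow> (int \<Rightarrow> 'o) \<Rightarrow> bool" where
  "ample C E \<longleftrightarrow> (\<forall>i. E i \<in> Obj C) \<and>
     (\<forall>X\<in>Obj C. \<forall>m. \<exists>is S \<iota> \<pi>. (\<forall>i\<in>set is. i \<ge> m) \<and>
        is_coproduct C (map (\<lambda>i. E (- i)) is) S \<iota> \<and> is_epi C S X \<pi>) \<and>
     (\<forall>X\<in>Obj C. \<forall>Y\<in>Obj C. \<forall>f. is_epi C X Y f \<longrightarrow>
        (\<exists>m. \<forall>i\<ge>m. (\<lambda>h. f \<cdot>\<^bsub>C\<^esub> h) ` Hom C (E (- i)) X = Hom C (E (- i)) Y))"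

text \<open>The functor \<open>- \<otimes> \<omega>\<^sup>-\<^sup>1\<close> is \<open>hom_from \<omega>\<close>; it is a quasi-inverse of \<open>tensor_with \<omega>\<close>, hence exact.\<close>

definition helix ::
  "('k, 'r) ring_scheme \<Rightarrow> ('o, 'm, 'k, 'z) lin_category_scheme \<Rightarrow> ('o, 'm) bimodule \<Rightarrow> int \<Rightarrow>
   (int \<Rightarrow> ('o, 'm) cochain) \<Rightarrow> bool" where
  "helix k C \<omega> l E \<longleftrightarrow> l \<ge> 1 \<and> (\<forall>i. E i \<in> Obj (Db C)) \<and>
     (\<forall>i. isomorphic (Db C) (E (i + l)) (omap (Db_lift C (hom_from \<omega>)) (E i))) \<and>
     (\<forall>i. (\<exists>\<phi>. linear_iso k (Ext_space C 0 (E i) (E i)) (field_space k) \<phi>) \<and>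
          (\<forall>q. q \<noteq> 0 \<longrightarrow> zero_space (Ext_space C q (E i) (E i)))) \<and>
     (\<forall>q i j. 0 < i - j \<and> i - j < l \<longrightarrow> zero_space (Ext_space C q (E i) (E j)))"

definition geometric :: "('o, 'm, 'k, 'z) lin_category_scheme \<Rightarrow> (int \<Rightarrow> ('o, 'm) cochain) \<Rightarrow> bool" where
  "geometric C E \<longleftrightarrow> (\<forall>q i j. q \<noteq> 0 \<and> i \<le> j \<longrightarrow> zero_space (Ext_space C q (E i) (E j)))"

definition full :: "('o, 'm, 'k, 'z) lin_category_scheme \<Rightarrow> int \<Rightarrow> (int \<Rightarrow> ('o, 'm) cochain) \<Rightarrow> bool" where
  "full C l E \<longleftrightarrow> (\<forall>i. thick_closure C (E ` {i..i + l - 1}) = Obj (Db C))"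


section \<open>Z-algebras and graded modules\<close>

record ('k, 'c) zalg =
  zcomp :: "int \<Rightarrow> int \<Rightarrow> ('k, 'c) module"
  zmul :: "int \<Rightarrow> int \<Rightarrow> int \<Rightarrow> 'c \<Rightarrow> 'c \<Rightarrow> 'c"
  zunit :: "int \<Rightarrow> 'c"

text \<open>A Z-algebra is given by its components; \<open>zmul A i j t\<close> is the multiplication
  \<open>A\<^sub>i\<^sub>j \<times> A\<^sub>j\<^sub>t \<rightarrow> A\<^sub>i\<^sub>t\<close>, all other products of homogeneous elements being zero.\<close>

locale zalgebra = field k
  for k :: "('k, 'r) ring_scheme" and A :: "('k, 'c) zalg" +
  assumes zcomp_vectorspace: "vectorspace k (zcomp A i j)"
    and zmul_linear_left: "b \<in> carrier (zcomp A j t) \<Longrightarrow>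
      (\<lambda>a. zmul A i j t a b) \<in> module_hom k (zcomp A i j) (zcomp A i t)"
    and zmul_linear_right: "a \<in> carrier (zcomp A i j) \<Longrightarrow>
      zmul A i j t a \<in> module_hom k (zcomp A j t) (zcomp A i t)"
    and zmul_assoc: "\<lbrakk>a \<in> carrier (zcomp A i j); b \<in> carrier (zcomp A j t); c \<in> carrier (zcomp A t u)\<rbrakk>
      \<Longrightarrow> zmul A i t u (zmul A i j t a b) c = zmul A i j u a (zmul A j t u b c)"
    and zunit_closed: "zunit A i \<in> carrier (zcomp A i i)"
    and zunit_left: "a \<in> carrier (zcomp A i j) \<Longrightarrow> zmul A i i j (zunit A i) a = a"
    and zunit_right: "a \<in> carrier (zcomp A i j) \<Longrightarrow> zmul A i j j a (zunit A j) = a"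

record ('k, 'c, 'm) grmod =
  gcomp :: "int \<Rightarrow> ('k, 'm) module"
  gact :: "int \<Rightarrow> int \<Rightarrow> 'm \<Rightarrow> 'c \<Rightarrow> 'm"

text \<open>\<open>gact M i j\<close> is the action \<open>M\<^sub>i \<times> A\<^sub>i\<^sub>j \<rightarrow> M\<^sub>j\<close>.\<close>

definition graded_right_module ::
  "('k, 'r) ring_scheme \<Rightarrow> ('k, 'c) zalg \<Rightarrow> ('k, 'c, 'm) grmod \<Rightarrow> bool" where
  "graded_right_module k A M \<longleftrightarrow>
     (\<forall>i. vectorspace k (gcomp M i)) \<and>
     (\<forall>i j. \<forall>a\<in>carrier (zcomp A i j). (\<lambda>x. gact M i j x a) \<in> module_hom k (gcomp M i) (gcomp M j)) \<and>
     (\<forall>i j. \<forall>x\<in>carrier (gcomp M i). gact M i j x \<in> module_hom k (zcomp A i j) (gcomp M j)) \<and>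
     (\<forall>i j t. \<forall>x\<in>carrier (gcomp M i). \<forall>a\<in>carrier (zcomp A i j). \<forall>b\<in>carrier (zcomp A j t).
        gact M j t (gact M i j x a) b = gact M i t x (zmul A i j t a b)) \<and>
     (\<forall>i. \<forall>x\<in>carrier (gcomp M i). gact M i i x (zunit A i) = x)"

text \<open>Morphisms carry their source and target; their components are extensional functions.\<close>

definition GrMod :: "('k, 'r) ring_scheme \<Rightarrow> ('k, 'c) zalg \<Rightarrow>
    (('k, 'c, 'm) grmod, ('k, 'c, 'm) grmod \<times> ('k, 'c, 'm) grmod \<times> (int \<Rightarrow> 'm \<Rightarrow> 'm)) category" where
  "GrMod k A = \<lparr>Obj = {M. graded_right_module k A M},
     Hom = (\<lambda>M N. {(M, N, f) | f.
        (\<forall>i. f i \<in> module_hom k (gcomp M i) (gcomp N i) \<inter> extensional (carrier (gcomp M i))) \<and>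
        (\<forall>i j. \<forall>x\<in>carrier (gcomp M i). \<forall>a\<in>carrier (zcomp A i j).
           f j (gact M i j x a) = gact N i j (f i x) a)}),
     Id = (\<lambda>M. (M, M, \<lambda>i. \<lambda>x\<in>carrier (gcomp M i). x)),
     cmp = (\<lambda>(M', N, g) (M, N', f). (M, N, \<lambda>i. compose (carrier (gcomp M i)) (g i) (f i)))\<rparr>"

text \<open>\<open>P\<^sub>i = e\<^sub>i A\<close>\<close>

definition proj_module :: "('k, 'c) zalg \<Rightarrow> int \<Rightarrow> ('k, 'c, 'c) grmod" where
  "proj_module A i = \<lparr>gcomp = zcomp A i, gact = zmul A i\<rparr>"

text \<open>Every subobject of \<open>P\<^sub>i\<close> is isomorphic to one whose underlying set consists of elements of
  \<open>A\<close>, so it is enough to consider graded modules with elements in the same type.\<close>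

definition right_noetherian :: "('k, 'r) ring_scheme \<Rightarrow> ('k, 'c) zalg \<Rightarrow> bool" where
  "right_noetherian k A \<longleftrightarrow> (\<forall>i. noetherian_object (GrMod k A) (proj_module A i))"

definition zalg_of :: "('o, 'm, 'k, 'z) lin_category_scheme \<Rightarrow> (int \<Rightarrow> 'o) \<Rightarrow> ('k, 'm) zalg" where
  "zalg_of C E = \<lparr>zcomp = (\<lambda>i j. hom_space C (E (- j)) (E (- i))),
     zmul = (\<lambda>i j t a b. a \<cdot>\<^bsub>C\<^esub> b), zunit = (\<lambda>i. Id C (E (- i)))\<rparr>"

definition zalg_nonneg :: "('k, 'c) zalg \<Rightarrow> ('k, 'c) zalg" where
  "zalg_nonneg A = A\<lparr>zcomp := (\<lambda>i j. if j - i \<ge> 0 then zcomp A i j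
     else (zcomp A i j)\<lparr>carrier := {\<zero>\<^bsub>zcomp A i j\<^esub>}\<rparr>)\<rparr>"


section \<open>Basic facts\<close>

lemma shift_0 [simp]: "shift C 0 X = X"
  by (simp add: shift_def)

lemma carrier_hom_space [simp]: "carrier (hom_space C X Y) = Hom C X Y"
  by (simp add: hom_space_def)

context linear_category
begin

lemma zero_mor_closed:
  assumes "X \<in> Obj C" "Y \<in> Obj C"
  shows "zero_mor C X Y \<in> Hom C X Y"
proof -
  interpret V: vectorspace k "hom_space C X Y" using hom_vectorspace assms by blast
  show ?thesis using V.M.zero_closed by (simp add: hom_space_def)
qed

lemma cmp_zero_right:
  assumes "X \<in> Obj C" "Y \<in> Obj C" "Z \<in> Obj C" "g \<in> Hom C Y Z"
  shows "g \<cdot> zero_mor C X Y = zero_mor C X Z"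
proof -
  interpret V: vectorspace k "hom_space C X Y" using hom_vectorspace assms by blast
  interpret W: vectorspace k "hom_space C X Z" using hom_vectorspace assms by blast
  interpret mod_hom k "hom_space C X Y" "hom_space C X Z" "\<lambda>f. g \<cdot> f"
    by unfold_locales (use cmp_linear_right assms in blast)
  show ?thesis using f0_is_0 by (simp add: hom_space_def)
qed

lemma stalk_in_Db:
  assumes "\<exists>Z. is_zero_object C Z" "X \<in> Obj C"
  shows "stalk C X \<in> Obj (Db C)"
proof -
  define Z where "Z = (SOME Z. is_zero_object C Z)"
  have Z: "is_zero_object C Z" unfolding Z_def using assms(1) by (rule someI_ex)
  define c where "c = (\<lambda>n::int. if n = 0 then X else Z)"
  have c: "c n \<in> Obj C" for n
    using Z assms(2) by (simp add: c_def is_zero_object_def)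
  have "\<forall>n. \<bar>n\<bar> > 0 \<longrightarrow> is_zero_object C (c n)"
    using Z by (simp add: c_def)
  then have b: "\<exists>N. \<forall>n. \<bar>n\<bar> > N \<longrightarrow> is_zero_object C (c n)" ..
  have "stalk C X = \<lparr>cob = c, cdiff = \<lambda>n. zero_mor C (c n) (c (n + 1))\<rparr>"
    by (simp only: stalk_def Let_def c_def Z_def)
  moreover have "zero_mor C (c (n + 1)) (c (n + 1 + 1)) \<cdot> zero_mor C (c n) (c (n + 1)) =
      zero_mor C (c n) (c (n + 1 + 1))" for n
    by (rule cmp_zero_right[OF c c c zero_mor_closed[OF c c]])
  ultimately show ?thesis
    using b c zero_mor_closed[OF c c] by (simp add: Db_def bounded_complexes_def)
qed

lemma zalgebra_zalg_of:
  assumes E: "\<And>i. E i \<in> Obj C"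
  shows "zalgebra k (zalg_of C E)"
proof (rule zalgebra.intro[OF field_axioms zalgebra_axioms.intro], goal_cases)
  case (1 i j)
  then show ?case by (simp add: zalg_of_def hom_vectorspace E)
next
  case (2 b j t i)
  then show ?case by (simp add: zalg_of_def cmp_linear_left E)
next
  case (3 a i j t)
  then show ?case using cmp_linear_right[OF E E E] by (simp add: zalg_of_def)
next
  case (4 a i j b t c u)
  then show ?case using cmp_assoc[OF E E E E] by (simp add: zalg_of_def)
next
  case (5 i)
  then show ?case by (simp add: zalg_of_def Id_closed E)
next
  case (6 a i j)
  then show ?case using Id_left[OF E E] by (simp add: zalg_of_def)
next
  case (7 a i j)
  then show ?case using Id_right[OF E E] by (simp add: zalg_of_def)
qed

end

lemma vectorspace_zero:
  assumes "vectorspace k V"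
  shows "vectorspace k (V\<lparr>carrier := {\<zero>\<^bsub>V\<^esub>}\<rparr>)"
proof -
  interpret V: vectorspace k V by fact
  have "submodule k {\<zero>\<^bsub>V\<^esub>} V"
    by (rule submodule.intro) (auto intro: V.module.module_axioms V.module_axioms)
  then show ?thesis
    by (intro V.subspace_is_vs subspace.intro) (auto intro: assms)
qed

lemma zalgebra_zalg_nonneg:
  assumes "zalgebra k A"
  shows "zalgebra k (zalg_nonneg A)"
proof -
  interpret zalgebra k A by fact
  note l = zmul_linear_left[unfolded module_hom_def] and r = zmul_linear_right[unfolded module_hom_def]
  have zc: "\<zero>\<^bsub>zcomp A i j\<^esub> \<in> carrier (zcomp A i j)" for i j
    by (rule abelian_monoid.zero_closed[OF abelian_group.axioms(1)[OF module.axioms(2)[OF vectorspace.axioms(1)[OF zcomp_vectorspace]]]])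
  have mod: "module k (zcomp A i j)" for i j
    using zcomp_vectorspace[of i j] by (rule vectorspace.axioms(1))
  have zl: "zmul A i j t \<zero>\<^bsub>zcomp A i j\<^esub> b = \<zero>\<^bsub>zcomp A i t\<^esub>" if "b \<in> carrier (zcomp A j t)" for i j t b
    using mod_hom.f0_is_0[OF mod_hom.intro[OF mod mod mod_hom_axioms.intro[OF zmul_linear_left[OF that]]]] .
  have zr: "zmul A i j t a \<zero>\<^bsub>zcomp A j t\<^esub> = \<zero>\<^bsub>zcomp A i t\<^esub>" if "a \<in> carrier (zcomp A i j)" for i j t a
    using mod_hom.f0_is_0[OF mod_hom.intro[OF mod mod mod_hom_axioms.intro[OF zmul_linear_right[OF that]]]] .
  have sub: "carrier (zcomp (zalg_nonneg A) i j) \<subseteq> carrier (zcomp A i j)" for i j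
    using zc by (auto simp: zalg_nonneg_def)
  have ops: "add (zcomp (zalg_nonneg A) i j) = add (zcomp A i j)"
    "smult (zcomp (zalg_nonneg A) i j) = smult (zcomp A i j)" "zmul (zalg_nonneg A) = zmul A"
    "zunit (zalg_nonneg A) = zunit A" for i j
    by (auto simp: zalg_nonneg_def)
  have cl: "zmul A i j t a b \<in> carrier (zcomp (zalg_nonneg A) i t)"
    if "a \<in> carrier (zcomp (zalg_nonneg A) i j)" "b \<in> carrier (zcomp (zalg_nonneg A) j t)" for i j t a b
  proof -
    have ab: "a \<in> carrier (zcomp A i j)" "b \<in> carrier (zcomp A j t)" using that sub by blast+
    then have "zmul A i j t a b \<in> carrier (zcomp A i t)" using r[of a i j t] by auto
    moreover have "zmul A i j t a b = \<zero>\<^bsub>zcomp A i t\<^esub>" if "t < i"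
    proof (cases "j < i")
      case True
      with \<open>a \<in> carrier (zcomp (zalg_nonneg A) i j)\<close> have "a = \<zero>\<^bsub>zcomp A i j\<^esub>"
        by (simp add: zalg_nonneg_def)
      then show ?thesis using zl ab by simp
    next
      case False
      with \<open>b \<in> carrier (zcomp (zalg_nonneg A) j t)\<close> \<open>t < i\<close> have "b = \<zero>\<^bsub>zcomp A j t\<^esub>"
        by (simp add: zalg_nonneg_def)
      then show ?thesis using zr ab by simp
    qed
    ultimately show ?thesis by (auto simp: zalg_nonneg_def)
  qed
  show ?thesis
  proof (rule zalgebra.intro[OF field_axioms zalgebra_axioms.intro], goal_cases)
    case (1 i j)
    then show ?case using zcomp_vectorspace[of i j] vectorspace_zero[OF zcomp_vectorspace[of i j]]
      by (auto simp: zalg_nonneg_def)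
  next
    case (2 b j t i)
    then have b: "b \<in> carrier (zcomp A j t)" using sub by blast
    show ?case using l[OF b, of i] sub[of i j] cl[OF _ 2, of _ i]
      by (simp add: module_hom_def ops subset_iff)
  next
    case (3 a i j t)
    then have a: "a \<in> carrier (zcomp A i j)" using sub by blast
    show ?case using r[OF a, of t] sub[of j t] cl[OF 3, of _ t]
      by (simp add: module_hom_def ops subset_iff)
  next
    case (4 a i j b t c u)
    then have "a \<in> carrier (zcomp A i j)" "b \<in> carrier (zcomp A j t)" "c \<in> carrier (zcomp A t u)"
      using sub by blast+
    then show ?case unfolding ops by (rule zmul_assoc)
  next
    case (5 i)
    then show ?case using zunit_closed by (simp add: zalg_nonneg_def)
  next
    case (6 a i j)
    then have "a \<in> carrier (zcomp A i j)" using sub by blast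
    then show ?case unfolding ops by (rule zunit_left)
  next
    case (7 a i j)
    then have "a \<in> carrier (zcomp A i j)" using sub by blast
    then show ?case unfolding ops by (rule zunit_right)
  qed
qed

lemma proj_module_in_GrMod:
  assumes "zalgebra k A"
  shows "proj_module A i \<in> Obj (GrMod k A)"
proof -
  interpret zalgebra k A by fact
  show ?thesis
    by (auto simp: GrMod_def graded_right_module_def proj_module_def
        intro: zcomp_vectorspace zmul_linear_left zmul_linear_right zmul_assoc zunit_right)
qed

lemma category_GrMod:
  "category (GrMod k A :: (('k, 'c, 'm) grmod, _) category)"
proof (unfold_locales, goal_cases)
  case (1 X)
  then show ?case
    by (auto simp: GrMod_def module_hom_def graded_right_module_def vectorspace_def module_def
        module_axioms_def abelian_group_def abelian_monoid.a_closed Pi_def)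
next
  case (2 X Y Z f g)
  then show ?case by (auto simp: GrMod_def module_hom_def compose_def Pi_def graded_right_module_def vectorspace_def module_def
        module_axioms_def abelian_group_def abelian_monoid.a_closed)
next
  case (3 X Y f)
  then show ?case
    by (auto simp: GrMod_def module_hom_def compose_def Pi_def extensional_def fun_eq_iff)
next
  case (4 X Y f)
  then show ?case
    by (auto simp: GrMod_def module_hom_def compose_def Pi_def extensional_def fun_eq_iff)
next
  case (5 W X Y Z f g h)
  then show ?case
    by (auto simp: GrMod_def module_hom_def compose_def Pi_def extensional_def fun_eq_iff)
next
  case (6 X Y X' Y' f)
  then show ?case by (auto simp: GrMod_def)
qed

end

(*
Graded submodules of P_i correspond to subfunctors of Hom(-, E_{-i}) on the objects E_{-j}, j >= i.

(3) => (1): a chain of such subfunctors is controlled, in large degrees, by a maximal subobject of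
E_{-i} whose morphisms from E_{-j}, j large, all lie in the chain; the finitely many remaining
degrees are finite-dimensional.

(1) => (2): choose an epimorphism onto X from a finite sum of E_{-i}. By (A2) all of Hom(E_{-j}, X)
comes from that sum for large j, so chains of subfunctors of Hom(E_{-j}, X), j large, stabilise; by
(A1) a subobject of X is determined by the morphisms E_{-j} -> X, j large, that factor through it.
*)
theory Submission
  imports Defs
begin

text \<open>An epimorphism is surjective on Hom(E_{-j}, -) only for large j, with a bound that
  depends on the epimorphism. All chain conditions are therefore stated on degrees j >= m with m
  adjustable. In (1) => (2) the bound is raised once, for one cover of the object. In (3) => (1) it
  depends on the maximal subobject, and the finitely many degrees below it are where Hom-finiteness
  enters. That subobject is chosen maximal over all members of the chain together: one choice per
  member would give bounds that could grow along the chain. In (1) => (2) no chain condition is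
  proved for Hom(-, S) with S the covering sum. The images of the summands are added one at a time
  inside Hom(-, X), as in the proof that extensions of noetherian modules are noetherian; this is
  why the chain condition carries an upper bound \<open>G\<close>. The implication (2) => (3) is
  immediate.\<close>

section \<open>Linear algebra: differences and chains of subspaces\<close>

lemma (in abelian_group) minus_add_cancel:
  assumes "x \<in> carrier G" "y \<in> carrier G"
  shows "(x \<ominus> y) \<oplus> y = x"
  using assms by (simp add: a_minus_def a_assoc l_neg)

lemma (in abelian_group) eq_if_minus_eq_zero:
  assumes "x \<in> carrier G" "y \<in> carrier G" "x \<ominus> y = \<zero>"
  shows "x = y"
  using minus_add_cancel[OF assms(1,2)] assms by simp

lemma (in abelian_group) add_minus_add_right:
  assumes "x \<in> carrier G" "y \<in> carrier G" "z \<in> carrier G"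
  shows "(x \<oplus> z) \<ominus> (y \<oplus> z) = x \<ominus> y"
proof -
  have "(x \<oplus> z) \<ominus> (y \<oplus> z) = x \<oplus> (z \<oplus> (\<ominus> z \<oplus> \<ominus> y))"
    using assms by (simp add: a_minus_def minus_add a_ac)
  also have "\<dots> = x \<ominus> y"
    using assms by (simp add: a_minus_def r_neg a_assoc[symmetric])
  finally show ?thesis .
qed

text \<open>Independent sets have at most \<open>dim\<close> elements, so among those contained in
  some member there is one of largest size, \<open>A\<close> in \<open>U N\<close>. A vector of
  \<open>U n\<close> outside \<open>span A\<close> would enlarge \<open>A\<close> to an independent
  set inside \<open>U (max n N)\<close>. Hence every member lies in \<open>span A\<close>, which is
  contained in \<open>U N\<close>.\<close>

lemma (in vectorspace) fin_dim_subspace_chain: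
  assumes "fin_dim" and U: "\<And>n::nat. submodule K (U n) V" and inc: "\<And>n. U n \<subseteq> U (Suc n)"
  shows "\<exists>N. \<forall>n. U n \<subseteq> U N"
proof -
  have mono: "U n \<subseteq> U n'" if "n \<le> n'" for n n'
    using inc that by (rule lift_Suc_mono_le)
  have UV: "U n \<subseteq> carrier V" for n using U by (rule submodule.subset)
  define P where "P c \<longleftrightarrow> (\<exists>A n. A \<subseteq> U n \<and> lin_indpt A \<and> card A = c)" for c
  have "lin_indpt {}" by (simp add: lin_dep_def)
  then have "P 0" unfolding P_def by (intro exI[of _ "{}"]) simp
  moreover have "\<forall>c. P c \<longrightarrow> c \<le> dim"
    unfolding P_def using li_le_dim(2)[OF \<open>fin_dim\<close>] UV by blast
  ultimately obtain c where c: "P c" "\<And>c'. P c' \<Longrightarrow> c' \<le> c"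
    using Nat.ex_has_greatest_nat[of P 0 dim] by auto
  then obtain A N where A: "A \<subseteq> U N" "lin_indpt A" "card A = c"
    unfolding P_def by blast
  have AV: "A \<subseteq> carrier V" using A UV by blast
  have finA: "finite A" using li_le_dim(1)[OF \<open>fin_dim\<close> AV A(2)] .
  have "U n \<subseteq> U N" for n
  proof
    fix v assume v: "v \<in> U n"
    have "v \<in> span A"
    proof (rule ccontr)
      assume nv: "v \<notin> span A"
      then have "v \<notin> A" using in_own_span[OF AV] by blast
      moreover have "v \<in> carrier V" using v UV by blast
      ultimately have "lin_indpt (A \<union> {v})"
        using lin_dep_iff_in_span[OF AV A(2)] nv by blast
      moreover have "A \<union> {v} \<subseteq> U (max n N)"
        using A(1) v mono[of n "max n N"] mono[of N "max n N"] by auto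
      ultimately have "P (card (A \<union> {v}))" unfolding P_def by blast
      then show False using c(2)[of "card (A \<union> {v})"] A(3) finA \<open>v \<notin> A\<close> by simp
    qed
    then show "v \<in> U N" using span_is_subset[OF A(1) U] by blast
  qed
  then show ?thesis by blast
qed

section \<open>Graded submodules\<close>

definition graded_submodule ::
  "('k, 'r) ring_scheme \<Rightarrow> ('k, 'c) zalg \<Rightarrow> ('k, 'c, 'm) grmod \<Rightarrow> (int \<Rightarrow> 'm set) \<Rightarrow> bool" where
  "graded_submodule k A M F \<longleftrightarrow> (\<forall>i. submodule k (F i) (gcomp M i)) \<and>
     (\<forall>i j. \<forall>x\<in>F i. \<forall>a\<in>carrier (zcomp A i j). gact M i j x a \<in> F j)"

text \<open>Only the carriers shrink, so elements keep their type. A graded submodule thus yields an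
  object of the same category \<open>GrMod\<close>, over which \<open>noetherian_object\<close>
  quantifies.\<close>

definition gr_restrict :: "('k, 'c, 'm) grmod \<Rightarrow> (int \<Rightarrow> 'm set) \<Rightarrow> ('k, 'c, 'm) grmod" where
  "gr_restrict M F = M\<lparr>gcomp := \<lambda>i. (gcomp M i)\<lparr>carrier := F i\<rparr>\<rparr>"

lemma gr_restrict_simps [simp]:
  "gact (gr_restrict M F) = gact M"
  "carrier (gcomp (gr_restrict M F) i) = F i"
  "add (gcomp (gr_restrict M F) i) = add (gcomp M i)"
  "smult (gcomp (gr_restrict M F) i) = smult (gcomp M i)"
  "zero (gcomp (gr_restrict M F) i) = zero (gcomp M i)"
  by (simp_all add: gr_restrict_def)

lemma graded_right_module_restrict:
  assumes M: "graded_right_module k A M" and F: "graded_submodule k A M F"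
  shows "graded_right_module k A (gr_restrict M F)"
proof -
  have sm: "submodule k (F i) (gcomp M i)" for i using F by (simp add: graded_submodule_def)
  have sub: "x \<in> carrier (gcomp M i)" if "x \<in> F i" for x i
    using submodule.subset[OF sm] that by blast
  have cl: "gact M i j x a \<in> F j" if "x \<in> F i" "a \<in> carrier (zcomp A i j)" for i j x a
    using F that by (simp add: graded_submodule_def)
  have vs: "vectorspace k (gcomp (gr_restrict M F) i)" for i
  proof -
    interpret vectorspace k "gcomp M i" using M by (simp add: graded_right_module_def)
    show ?thesis using subspace_is_vs[OF subspace.intro, OF vectorspace_axioms sm]
      by (simp add: gr_restrict_def)
  qed
  from M show ?thesis
    unfolding graded_right_module_def
    by (auto simp: vs module_hom_def sub cl Pi_def)
qed

text \<open>The identity is cut down to \<open>F i\<close> because the components of morphisms in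
  \<open>GrMod\<close> must be extensional.\<close>

definition gr_inclusion :: "('k, 'c, 'm) grmod \<Rightarrow> (int \<Rightarrow> 'm set) \<Rightarrow>
    ('k, 'c, 'm) grmod \<times> ('k, 'c, 'm) grmod \<times> (int \<Rightarrow> 'm \<Rightarrow> 'm)" where
  "gr_inclusion M F = (gr_restrict M F, M, \<lambda>i. \<lambda>x\<in>F i. x)"

lemma gr_inclusion_hom:
  assumes "graded_submodule k A M F"
  shows "gr_inclusion M F \<in> Hom (GrMod k A) (gr_restrict M F) M"
proof -
  have sm: "submodule k (F i) (gcomp M i)" for i using assms by (simp add: graded_submodule_def)
  note [simp] = submodule.smult_closed[OF sm] submodule.m_closed[OF sm] subsetD[OF submodule.subset[OF sm]]
  show ?thesis
    using assms by (auto simp: GrMod_def gr_inclusion_def module_hom_def graded_submodule_def)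
qed

lemma gr_mono_if_inj:
  assumes f: "(M, N, f) \<in> Hom (GrMod k A) M N" and inj: "\<And>i. inj_on (f i) (carrier (gcomp M i))"
  shows "is_mono (GrMod k A) M N (M, N, f)"
  unfolding is_mono_def
proof (intro conjI ballI impI f)
  fix W g h
  assume "g \<in> Hom (GrMod k A) W M" "h \<in> Hom (GrMod k A) W M"
    and eq: "(M, N, f) \<cdot>\<^bsub>GrMod k A\<^esub> g = (M, N, f) \<cdot>\<^bsub>GrMod k A\<^esub> h"
  then obtain g' h' where g: "g = (W, M, g')" "\<And>i. g' i \<in> module_hom k (gcomp W i) (gcomp M i) \<inter> extensional (carrier (gcomp W i))"
    and h: "h = (W, M, h')" "\<And>i. h' i \<in> module_hom k (gcomp W i) (gcomp M i) \<inter> extensional (carrier (gcomp W i))"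
    by (auto simp: GrMod_def)
  have "g' i = h' i" for i
  proof (rule extensionalityI)
    show "g' i \<in> extensional (carrier (gcomp W i))" "h' i \<in> extensional (carrier (gcomp W i))"
      using g h by auto
    fix x assume x: "x \<in> carrier (gcomp W i)"
    from eq have "compose (carrier (gcomp W i)) (f i) (g' i) x = compose (carrier (gcomp W i)) (f i) (h' i) x"
      by (simp add: g h GrMod_def fun_eq_iff)
    then have "f i (g' i x) = f i (h' i x)" using x by (simp add: compose_eq)
    moreover have "g' i x \<in> carrier (gcomp M i)" "h' i x \<in> carrier (gcomp M i)"
      using g(2)[of i] h(2)[of i] x by (auto simp: module_hom_def)
    ultimately show "g' i x = h' i x" using inj[of i] by (simp add: inj_on_eq_iff)
  qed
  then show "g = h" using g h by auto
qed

text \<open>The degreewise kernel \<open>K\<close> of \<open>f\<close> is a graded submodule, hence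
  a legitimate test object. Its inclusion and the zero map \<open>zer\<close> have the same
  composite with \<open>f\<close>, so they agree and \<open>K\<close> is zero.\<close>

lemma gr_mono_imp_inj:
  assumes M: "graded_right_module k A M" and N: "graded_right_module k A N"
    and mono: "is_mono (GrMod k A) M N (M, N, f)"
  shows "inj_on (f i) (carrier (gcomp M i))"
proof -
  have fh: "\<And>i. f i \<in> module_hom k (gcomp M i) (gcomp N i)"
    and fa: "\<And>i j x a. \<lbrakk>x \<in> carrier (gcomp M i); a \<in> carrier (zcomp A i j)\<rbrakk>
       \<Longrightarrow> f j (gact M i j x a) = gact N i j (f i x) a"
    using mono by (auto simp: is_mono_def GrMod_def)
  have vM: "vectorspace k (gcomp M i)" and vN: "vectorspace k (gcomp N i)" for i
    using M N by (auto simp: graded_right_module_def)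
  have mh: "mod_hom k (gcomp M i) (gcomp N i) (f i)" for i
    by (intro mod_hom.intro mod_hom_axioms.intro vectorspace.axioms(1) vM vN fh)
  have mhM: "mod_hom k (gcomp M i) (gcomp M j) (\<lambda>x. gact M i j x a)"
    and mhN: "mod_hom k (gcomp N i) (gcomp N j) (\<lambda>x. gact N i j x a)"
    if "a \<in> carrier (zcomp A i j)" for i j a
    using M N that by (auto intro!: mod_hom.intro mod_hom_axioms.intro vectorspace.axioms(1) vM vN
        simp: graded_right_module_def)
  define K where "K i = mod_hom.ker (gcomp M i) (gcomp N i) (f i)" for i
  have Kiff: "x \<in> K i \<longleftrightarrow> x \<in> carrier (gcomp M i) \<and> f i x = \<zero>\<^bsub>gcomp N i\<^esub>" for x i
    unfolding K_def by (simp add: mod_hom.ker_def[OF mh])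
  have Ksm: "submodule k (K i) (gcomp M i)" for i
    unfolding K_def by (rule mod_hom.ker_is_submodule[OF mh])
  have K: "graded_submodule k A M K"
    unfolding graded_submodule_def
    using Ksm mod_hom.f_im[OF mhM] mod_hom.f0_is_0[OF mhN] by (auto simp: Kiff fa)
  have z: "\<zero>\<^bsub>gcomp M i\<^esub> \<in> carrier (gcomp M i)" for i
    using submodule.zero_closed[OF Ksm] Kiff by blast
  define zer where "zer = (gr_restrict M K, M, \<lambda>i. \<lambda>x\<in>K i. \<zero>\<^bsub>gcomp M i\<^esub>)"
  have "zer \<in> Hom (GrMod k A) (gr_restrict M K) M"
  proof -
    have "\<zero>\<^bsub>gcomp M i\<^esub> \<oplus>\<^bsub>gcomp M i\<^esub> \<zero>\<^bsub>gcomp M i\<^esub> = \<zero>\<^bsub>gcomp M i\<^esub>"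
      "c \<in> carrier k \<Longrightarrow> c \<odot>\<^bsub>gcomp M i\<^esub> \<zero>\<^bsub>gcomp M i\<^esub> = \<zero>\<^bsub>gcomp M i\<^esub>" for i c
    proof -
      interpret vectorspace k "gcomp M i" by (rule vM)
      show "\<zero>\<^bsub>gcomp M i\<^esub> \<oplus>\<^bsub>gcomp M i\<^esub> \<zero>\<^bsub>gcomp M i\<^esub> = \<zero>\<^bsub>gcomp M i\<^esub>"
        "c \<in> carrier k \<Longrightarrow> c \<odot>\<^bsub>gcomp M i\<^esub> \<zero>\<^bsub>gcomp M i\<^esub> = \<zero>\<^bsub>gcomp M i\<^esub>" by simp_all
    qed
    then show ?thesis
      using K mod_hom.f0_is_0[OF mhM]
      by (auto simp: zer_def GrMod_def module_hom_def z graded_submodule_def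
          submodule.m_closed[OF Ksm] submodule.smult_closed[OF Ksm])
  qed
  moreover have "(M, N, f) \<cdot>\<^bsub>GrMod k A\<^esub> gr_inclusion M K = (M, N, f) \<cdot>\<^bsub>GrMod k A\<^esub> zer"
    using mod_hom.f0_is_0[OF mh]
    by (auto simp: GrMod_def zer_def gr_inclusion_def compose_def fun_eq_iff Kiff)
  moreover have "gr_restrict M K \<in> Obj (GrMod k A)"
    using graded_right_module_restrict[OF M K] by (simp add: GrMod_def)
  ultimately have "gr_inclusion M K = zer"
    using mono gr_inclusion_hom[OF K] unfolding is_mono_def by blast
  then have eq: "restrict (\<lambda>x. x) (K j) = restrict (\<lambda>x. \<zero>\<^bsub>gcomp M j\<^esub>) (K j)" for j
    by (simp add: gr_inclusion_def zer_def fun_eq_iff)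
  have triv: "x = \<zero>\<^bsub>gcomp M i\<^esub>" if "x \<in> K i" for x
    using fun_cong[OF eq[of i], of x] that by simp
  show ?thesis
  proof (rule inj_onI)
    interpret mod_hom k "gcomp M i" "gcomp N i" "f i" by (rule mh)
    fix x y assume xy: "x \<in> carrier (gcomp M i)" "y \<in> carrier (gcomp M i)" "f i x = f i y"
    then have "x \<ominus>\<^bsub>gcomp M i\<^esub> y \<in> K i" by (simp add: Kiff a_minus_def N.M.r_neg)
    then show "x = y" using triv xy M.M.eq_if_minus_eq_zero by simp
  qed
qed

text \<open>Replaces monomorphisms preordered by factorisation with honest inclusions of sets. A
  submodule goes to its inclusion and a monomorphism to its image; since monomorphisms are
  injective, containment of images gives back a factorisation.\<close>

lemma noetherian_object_GrMod_iff:
  assumes M: "graded_right_module k A M"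
  shows "noetherian_object (GrMod k A) M \<longleftrightarrow>
    (\<forall>F. (\<forall>n::nat. graded_submodule k A M (F n)) \<and> (\<forall>n i. F n i \<subseteq> F (Suc n) i)
       \<longrightarrow> (\<exists>N. \<forall>n\<ge>N. \<forall>i. F n i \<subseteq> F N i))" (is "?L \<longleftrightarrow> ?R")
proof
  assume ?L
  show ?R
  proof (intro allI impI, elim conjE)
    fix F :: "nat \<Rightarrow> int \<Rightarrow> _"
    assume F: "\<forall>n. graded_submodule k A M (F n)" and inc: "\<forall>n i. F n i \<subseteq> F (Suc n) i"
    define S where "S n = gr_restrict M (F n)" for n
    define m where "m n = gr_inclusion M (F n)" for n
    have mh: "m n \<in> Hom (GrMod k A) (S n) M" for n
      unfolding m_def S_def using F by (intro gr_inclusion_hom) auto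
    have "is_mono (GrMod k A) (S n) M (m n)" for n
      unfolding m_def gr_inclusion_def S_def
      by (rule gr_mono_if_inj)
        (use mh[of n] in \<open>auto simp: m_def gr_inclusion_def S_def inj_on_def\<close>)
    moreover have "S n \<in> Obj (GrMod k A)" for n
      using graded_right_module_restrict[OF M] F by (simp add: S_def GrMod_def)
    moreover have "subobject_le (GrMod k A) (S n) (m n) (S (Suc n)) (m (Suc n))" for n
      unfolding subobject_le_def
    proof (rule bexI)
      show "m (Suc n) \<cdot>\<^bsub>GrMod k A\<^esub> (S n, S (Suc n), \<lambda>i. \<lambda>x\<in>F n i. x) = m n"
        using inc by (auto simp: m_def gr_inclusion_def S_def GrMod_def compose_def fun_eq_iff)
      show "(S n, S (Suc n), \<lambda>i. \<lambda>x\<in>F n i. x) \<in> Hom (GrMod k A) (S n) (S (Suc n))"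
      proof -
        have sm: "submodule k (F n i) (gcomp M i)" for i using F by (simp add: graded_submodule_def)
        show ?thesis using inc F
          by (auto simp: GrMod_def S_def module_hom_def submodule.m_closed[OF sm]
              submodule.smult_closed[OF sm] graded_submodule_def)
      qed
    qed
    ultimately obtain N where N: "\<And>n. n \<ge> N \<Longrightarrow> subobject_le (GrMod k A) (S n) (m n) (S N) (m N)"
      using \<open>?L\<close> unfolding noetherian_object_def by blast
    have "F n i \<subseteq> F N i" if "n \<ge> N" for n i
    proof
      fix x assume x: "x \<in> F n i"
      from N[OF that] obtain h where h: "h \<in> Hom (GrMod k A) (S n) (S N)" "m N \<cdot>\<^bsub>GrMod k A\<^esub> h = m n"
        unfolding subobject_le_def by blast
      then obtain h' where h': "h = (S n, S N, h')" "h' i \<in> module_hom k (gcomp (S n) i) (gcomp (S N) i)"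
        by (auto simp: GrMod_def)
      have hx: "h' i x \<in> F N i" using h'(2) x by (auto simp: module_hom_def S_def)
      \<comment> \<open>Both monomorphisms are inclusions, so the factorisation \<open>h'\<close>
        must fix \<open>x\<close>, and its values lie in \<open>F N i\<close>.\<close>
      have "compose (F n i) (\<lambda>x\<in>F N i. x) (h' i) x = x"
        using h(2) x by (auto simp: h'(1) m_def gr_inclusion_def S_def GrMod_def fun_eq_iff)
      then show "x \<in> F N i" using hx x by (simp add: compose_eq)
    qed
    then show "\<exists>N. \<forall>n\<ge>N. \<forall>i. F n i \<subseteq> F N i" by blast
  qed
next
  assume R: ?R
  show ?L
    unfolding noetherian_object_def
  proof (intro conjI allI impI)
    show "M \<in> Obj (GrMod k A)" using M by (simp add: GrMod_def)
    fix S m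
    assume "(\<forall>n::nat. S n \<in> Obj (GrMod k A) \<and> is_mono (GrMod k A) (S n) M (m n)) \<and>
      (\<forall>n. subobject_le (GrMod k A) (S n) (m n) (S (Suc n)) (m (Suc n)))"
    then have S: "\<And>n. graded_right_module k A (S n)"
      and mono: "\<And>n. is_mono (GrMod k A) (S n) M (m n)"
      and le: "\<And>n. subobject_le (GrMod k A) (S n) (m n) (S (Suc n)) (m (Suc n))"
      by (auto simp: GrMod_def)
    define f where "f n = snd (snd (m n))" for n
    have m: "m n = (S n, M, f n)" for n
      using mono[of n] by (auto simp: is_mono_def GrMod_def f_def)
    have fh: "f n i \<in> module_hom k (gcomp (S n) i) (gcomp M i)"
      and fe: "f n i \<in> extensional (carrier (gcomp (S n) i))" for n i
      using mono[of n] by (auto simp: is_mono_def GrMod_def m)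
    have fa: "f n j (gact (S n) i j x a) = gact M i j (f n i x) a"
      if "x \<in> carrier (gcomp (S n) i)" "a \<in> carrier (zcomp A i j)" for n i j x a
      using mono[of n] that by (auto simp: is_mono_def GrMod_def m)
    have inj: "inj_on (f n i) (carrier (gcomp (S n) i))" for n i
      using gr_mono_imp_inj[OF S M, of n "f n"] mono[of n] by (simp add: m)
    have mh: "mod_hom k (gcomp (S n) i) (gcomp M i) (f n i)" for n i
      using S[of n] M fh
      by (auto intro!: mod_hom.intro mod_hom_axioms.intro vectorspace.axioms(1) simp: graded_right_module_def)
    have actS: "gact (S n) i j x a \<in> carrier (gcomp (S n) j)"
      if "x \<in> carrier (gcomp (S n) i)" "a \<in> carrier (zcomp A i j)" for n i j x a
    proof -
      have "gact (S n) i j x \<in> module_hom k (zcomp A i j) (gcomp (S n) j)"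
        using S[of n] that(1) by (simp add: graded_right_module_def)
      then show ?thesis using module_hom_closed that(2) by blast
    qed
    define F where "F n i = f n i ` carrier (gcomp (S n) i)" for n i
    have "graded_submodule k A M (F n)" for n
      unfolding graded_submodule_def
    proof (intro conjI allI ballI)
      show "submodule k (F n i) (gcomp M i)" for i
        using mod_hom.im_is_submodule[OF mh[of n i]] by (simp add: F_def mod_hom.im_def[OF mh])
      show "gact M i j x a \<in> F n j" if "x \<in> F n i" "a \<in> carrier (zcomp A i j)" for i j x a
        using that actS by (auto simp: F_def simp flip: fa)
    qed
    moreover have "F n i \<subseteq> F (Suc n) i" for n i
    proof -
      from le[of n] obtain h where h: "h \<in> Hom (GrMod k A) (S n) (S (Suc n))"
        "m (Suc n) \<cdot>\<^bsub>GrMod k A\<^esub> h = m n" unfolding subobject_le_def by blast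
      then obtain h' where h': "h = (S n, S (Suc n), h')"
        "h' i \<in> module_hom k (gcomp (S n) i) (gcomp (S (Suc n)) i)"
        by (auto simp: GrMod_def)
      have "compose (carrier (gcomp (S n) i)) (f (Suc n) i) (h' i) x = f n i x" for x
        using h(2) by (auto simp: h'(1) m GrMod_def fun_eq_iff)
      then have e: "f (Suc n) i (h' i x) = f n i x" if "x \<in> carrier (gcomp (S n) i)" for x
        using that by (metis compose_eq)
      have "h' i x \<in> carrier (gcomp (S (Suc n)) i)" if "x \<in> carrier (gcomp (S n) i)" for x
        using module_hom_closed[OF h'(2)] that by blast
      then show ?thesis unfolding F_def using e by (metis (no_types, lifting) image_eqI image_subsetI)
    qed
    ultimately have "\<exists>N. \<forall>n\<ge>N. \<forall>i. F n i \<subseteq> F N i" by (intro R[rule_format]) simp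
    then obtain N where N: "\<And>n i. n \<ge> N \<Longrightarrow> F n i \<subseteq> F N i" by blast
    have "subobject_le (GrMod k A) (S n) (m n) (S N) (m N)" if "n \<ge> N" for n
    proof -
      \<comment> \<open>The factorisation inverts the injective \<open>f N i\<close>, so
        \<open>h i x\<close> is the only \<open>y\<close> with \<open>f N i y = f n i x\<close>. By
        this uniqueness (\<open>heq\<close>), linearity of \<open>h\<close> and compatibility with
        the action follow from those of \<open>f n\<close> and \<open>f N\<close>.\<close>
      define h where "h i = (\<lambda>x\<in>carrier (gcomp (S n) i). inv_into (carrier (gcomp (S N) i)) (f N i) (f n i x))" for i
      have hx: "h i x \<in> carrier (gcomp (S N) i)" "f N i (h i x) = f n i x"
        if x: "x \<in> carrier (gcomp (S n) i)" for i x
      proof -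
        have "f n i x \<in> f N i ` carrier (gcomp (S N) i)" using N[OF \<open>n \<ge> N\<close>, of i] x by (auto simp: F_def)
        then show "h i x \<in> carrier (gcomp (S N) i)" "f N i (h i x) = f n i x"
          using x by (auto simp: h_def inv_into_into f_inv_into_f)
      qed
      have heq: "h i x = y" if "x \<in> carrier (gcomp (S n) i)" "y \<in> carrier (gcomp (S N) i)" "f n i x = f N i y" for i x y
        using inj_onD[OF inj[of N i], of "h i x" y] hx that by simp
      have "(S n, S N, h) \<in> Hom (GrMod k A) (S n) (S N)"
      proof -
        have "h i \<in> module_hom k (gcomp (S n) i) (gcomp (S N) i)" for i
        proof -
          interpret a: mod_hom k "gcomp (S n) i" "gcomp M i" "f n i" by (rule mh)
          interpret b: mod_hom k "gcomp (S N) i" "gcomp M i" "f N i" by (rule mh)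
          show ?thesis
            unfolding module_hom_def by (auto simp: hx intro!: heq)
        qed
        moreover have "h j (gact (S n) i j x a) = gact (S N) i j (h i x) a"
          if "x \<in> carrier (gcomp (S n) i)" "a \<in> carrier (zcomp A i j)" for i j x a
          using that by (intro heq) (simp_all add: actS hx fa)
        ultimately show ?thesis by (auto simp: GrMod_def h_def)
      qed
      moreover have "m N \<cdot>\<^bsub>GrMod k A\<^esub> (S n, S N, h) = m n"
        using fe by (auto simp: m GrMod_def fun_eq_iff compose_def hx extensional_def)
      ultimately show ?thesis unfolding subobject_le_def by blast
    qed
    then show "\<exists>N. \<forall>n\<ge>N. subobject_le (GrMod k A) (S n) (m n) (S N) (m N)" by blast
  qed
qed

section \<open>Linear categories: bilinear composition, monomorphisms and epimorphisms\<close>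

context linear_category
begin

lemma hom_module:
  assumes "X \<in> Obj C" "Y \<in> Obj C"
  shows "module k (hom_space C X Y)"
  using hom_vectorspace[OF assms] by (rule vectorspace.axioms(1))

lemma precomp_mod_hom:
  assumes "X \<in> Obj C" "Y \<in> Obj C" "Z \<in> Obj C" "f \<in> Hom C X Y"
  shows "mod_hom k (hom_space C Y Z) (hom_space C X Z) (\<lambda>g. g \<cdot> f)"
  by (intro mod_hom.intro mod_hom_axioms.intro hom_module cmp_linear_left assms)

lemma postcomp_mod_hom:
  assumes "X \<in> Obj C" "Y \<in> Obj C" "Z \<in> Obj C" "g \<in> Hom C Y Z"
  shows "mod_hom k (hom_space C X Y) (hom_space C X Z) (\<lambda>f. g \<cdot> f)"
  by (intro mod_hom.intro mod_hom_axioms.intro hom_module cmp_linear_right assms)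

lemma hom_space_simps [simp]:
  "zero (hom_space C X Y) = zero_mor C X Y"
  "add (hom_space C X Y) = add_mor C"
  "smult (hom_space C X Y) = smul_mor C"
  by (simp_all add: hom_space_def)

lemma add_mor_closed:
  assumes "X \<in> Obj C" "Y \<in> Obj C" "f \<in> Hom C X Y" "g \<in> Hom C X Y"
  shows "add_mor C f g \<in> Hom C X Y"
proof -
  interpret V: module k "hom_space C X Y" by (rule hom_module[OF assms(1,2)])
  show ?thesis using V.a_closed assms by simp
qed

lemma cmp_zero_left:
  assumes "X \<in> Obj C" "Y \<in> Obj C" "Z \<in> Obj C" "f \<in> Hom C X Y"
  shows "zero_mor C Y Z \<cdot> f = zero_mor C X Z"
  using mod_hom.f0_is_0[OF precomp_mod_hom[OF assms]] by simp

lemma cmp_add_left: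
  assumes "X \<in> Obj C" "Y \<in> Obj C" "Z \<in> Obj C" "f \<in> Hom C X Y" "g \<in> Hom C Y Z" "h \<in> Hom C Y Z"
  shows "add_mor C g h \<cdot> f = add_mor C (g \<cdot> f) (h \<cdot> f)"
  using module_hom_add[OF cmp_linear_left[OF assms(1-4)], of g h] assms by simp

lemma cmp_add_right:
  assumes "X \<in> Obj C" "Y \<in> Obj C" "Z \<in> Obj C" "f \<in> Hom C X Y" "g \<in> Hom C X Y" "h \<in> Hom C Y Z"
  shows "h \<cdot> add_mor C f g = add_mor C (h \<cdot> f) (h \<cdot> g)"
  using module_hom_add[OF cmp_linear_right[OF assms(1-3,6)], of f g] assms by simp

lemma cmp_smul_right:
  assumes "X \<in> Obj C" "Y \<in> Obj C" "Z \<in> Obj C" "f \<in> Hom C X Y" "h \<in> Hom C Y Z" "c \<in> carrier k"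
  shows "h \<cdot> smul_mor C c f = smul_mor C c (h \<cdot> f)"
  using module_hom_smult[OF cmp_linear_right[OF assms(1-3,5)], of c f] assms by simp

lemma add_zero_left:
  assumes "X \<in> Obj C" "Y \<in> Obj C" "f \<in> Hom C X Y"
  shows "add_mor C (zero_mor C X Y) f = f"
proof -
  interpret V: module k "hom_space C X Y" by (rule hom_module[OF assms(1,2)])
  show ?thesis using V.l_zero assms by simp
qed

lemma add_zero_right:
  assumes "X \<in> Obj C" "Y \<in> Obj C" "f \<in> Hom C X Y"
  shows "add_mor C f (zero_mor C X Y) = f"
proof -
  interpret V: module k "hom_space C X Y" by (rule hom_module[OF assms(1,2)])
  show ?thesis using V.r_zero assms by simp
qed

text \<open>Composition is additive, so a pair of maps with equal composites is handled through its
  difference \<open>d\<close>, which reduces cancellation to the case of a zero composite.\<close>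

lemma is_monoI:
  assumes XY: "X \<in> Obj C" "Y \<in> Obj C" and f: "f \<in> Hom C X Y"
    and z: "\<And>W h. \<lbrakk>W \<in> Obj C; h \<in> Hom C W X; f \<cdot> h = zero_mor C W Y\<rbrakk> \<Longrightarrow> h = zero_mor C W X"
  shows "is_mono C X Y f"
  unfolding is_mono_def
proof (intro conjI ballI impI f)
  fix W g h assume W: "W \<in> Obj C" "g \<in> Hom C W X" "h \<in> Hom C W X" and eq: "f \<cdot> g = f \<cdot> h"
  interpret mod_hom k "hom_space C W X" "hom_space C W Y" "\<lambda>g. f \<cdot> g"
    by (rule postcomp_mod_hom[OF W(1) XY f])
  define d where "d = g \<ominus>\<^bsub>hom_space C W X\<^esub> h"
  have "d \<in> Hom C W X" using M.M.minus_closed[of g h] W by (simp add: d_def)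
  moreover have "f \<cdot> h \<in> carrier (hom_space C W Y)" using cmp_closed[OF W(1) XY W(3) f] by simp
  then have "f \<cdot> d = zero_mor C W Y"
    using f_minus[of g h] W eq N.M.r_neg[of "f \<cdot> h"] by (simp add: d_def a_minus_def)
  ultimately have "d = zero_mor C W X" by (rule z[OF W(1)])
  then show "g = h" using M.M.eq_if_minus_eq_zero[of g h] W by (simp add: d_def)
qed

lemma is_epiI:
  assumes XY: "X \<in> Obj C" "Y \<in> Obj C" and f: "f \<in> Hom C X Y"
    and z: "\<And>W h. \<lbrakk>W \<in> Obj C; h \<in> Hom C Y W; h \<cdot> f = zero_mor C X W\<rbrakk> \<Longrightarrow> h = zero_mor C Y W"
  shows "is_epi C X Y f"
  unfolding is_epi_def
proof (intro conjI ballI impI f)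
  fix W g h assume W: "W \<in> Obj C" "g \<in> Hom C Y W" "h \<in> Hom C Y W" and eq: "g \<cdot> f = h \<cdot> f"
  interpret mod_hom k "hom_space C Y W" "hom_space C X W" "\<lambda>g. g \<cdot> f"
    by (rule precomp_mod_hom[OF XY W(1) f])
  define d where "d = g \<ominus>\<^bsub>hom_space C Y W\<^esub> h"
  have "d \<in> Hom C Y W" using M.M.minus_closed[of g h] W by (simp add: d_def)
  moreover have "h \<cdot> f \<in> carrier (hom_space C X W)" using cmp_closed[OF XY W(1) f W(3)] by simp
  then have "d \<cdot> f = zero_mor C X W"
    using f_minus[of g h] W eq N.M.r_neg[of "h \<cdot> f"] by (simp add: d_def a_minus_def)
  ultimately have "d = zero_mor C Y W" by (rule z[OF W(1)])
  then show "g = h" using M.M.eq_if_minus_eq_zero[of g h] W by (simp add: d_def)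
qed

lemma is_monoD:
  assumes XYW: "X \<in> Obj C" "Y \<in> Obj C" "W \<in> Obj C" and f: "is_mono C X Y f" and h: "h \<in> Hom C W X"
    and z: "f \<cdot> h = zero_mor C W Y"
  shows "h = zero_mor C W X"
proof -
  have fh: "f \<in> Hom C X Y" using f by (simp add: is_mono_def)
  have "f \<cdot> h = f \<cdot> zero_mor C W X"
    using z cmp_zero_right[OF XYW(3,1,2) fh] by simp
  then show ?thesis
    using f XYW h zero_mor_closed[OF XYW(3,1)] unfolding is_mono_def by blast
qed

lemma kernel_is_mono:
  assumes "X \<in> Obj C" "Y \<in> Obj C" "f \<in> Hom C X Y" "is_kernel C X Y f K \<kappa>"
  shows "is_mono C K X \<kappa>"
  unfolding is_mono_def
proof (intro conjI ballI impI)
  have K: "K \<in> Obj C" and \<kappa>: "\<kappa> \<in> Hom C K X" and z: "f \<cdot> \<kappa> = zero_mor C K Y"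
    using assms(4) by (auto simp: is_kernel_def)
  show "\<kappa> \<in> Hom C K X" by (rule \<kappa>)
  fix W g h assume W: "W \<in> Obj C" "g \<in> Hom C W K" "h \<in> Hom C W K" "\<kappa> \<cdot> g = \<kappa> \<cdot> h"
  have "f \<cdot> (\<kappa> \<cdot> g) = (f \<cdot> \<kappa>) \<cdot> g"
    using cmp_assoc[OF W(1) K assms(1,2) W(2) \<kappa> assms(3)] by simp
  also have "\<dots> = zero_mor C W Y" using cmp_zero_left[OF W(1) K assms(2) W(2)] z by simp
  finally have "\<exists>!h. h \<in> Hom C W K \<and> \<kappa> \<cdot> h = \<kappa> \<cdot> g"
    using assms(4) W(1) cmp_closed[OF W(1) K assms(1) W(2) \<kappa>] unfolding is_kernel_def by blast
  then show "g = h" using W by metis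
qed

lemma mono_cmp:
  assumes XYZ: "X \<in> Obj C" "Y \<in> Obj C" "Z \<in> Obj C" and f: "is_mono C X Y f" and g: "is_mono C Y Z g"
  shows "is_mono C X Z (g \<cdot> f)"
proof (rule is_monoI)
  have fh: "f \<in> Hom C X Y" and gh: "g \<in> Hom C Y Z" using f g by (auto simp: is_mono_def)
  show "g \<cdot> f \<in> Hom C X Z" by (rule cmp_closed[OF XYZ fh gh])
  fix W h assume W: "W \<in> Obj C" "h \<in> Hom C W X" "g \<cdot> f \<cdot> h = zero_mor C W Z"
  then have "g \<cdot> (f \<cdot> h) = zero_mor C W Z" using cmp_assoc[OF W(1) XYZ W(2) fh gh] by simp
  then have "f \<cdot> h = zero_mor C W Y"
    using is_monoD[OF XYZ(2,3) W(1) g] cmp_closed[OF W(1) XYZ(1,2) W(2) fh] by blast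
  then show "h = zero_mor C W X" using is_monoD[OF XYZ(1,2) W(1) f W(2)] by blast
qed (use XYZ in auto)

end

text \<open>The image \<open>m\<close> is the kernel of the cokernel \<open>c\<close> of
  \<open>f\<close>. The work is to show that the corestriction \<open>e\<close> is epi: if
  \<open>u\<close> kills \<open>e\<close>, then \<open>e\<close> factors through the kernel \<kappa>
  of \<open>u\<close>, and \<kappa> turns out to be all of \<open>I\<close>.\<close>

lemma (in abelian_category) image_factorization:
  assumes XY: "X \<in> Obj C" "Y \<in> Obj C" and f: "f \<in> Hom C X Y"
  obtains I m e where "I \<in> Obj C" "is_mono C I Y m" "is_epi C X I e" "m \<cdot> e = f"
proof -
  obtain Q c where c: "is_cokernel C X Y f Q c" using cokernel_exists[OF XY f] by blast
  then have Q: "Q \<in> Obj C" "c \<in> Hom C Y Q" "c \<cdot> f = zero_mor C X Q" by (auto simp: is_cokernel_def)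
  obtain I m where m: "is_kernel C Y Q c I m" using kernel_exists[OF XY(2) Q(1,2)] by blast
  then have I: "I \<in> Obj C" "m \<in> Hom C I Y" "c \<cdot> m = zero_mor C I Q" by (auto simp: is_kernel_def)
  obtain e where e: "e \<in> Hom C X I" "m \<cdot> e = f"
    using m XY(1) f Q(3) unfolding is_kernel_def by metis
  have mono: "is_mono C I Y m" by (rule kernel_is_mono[OF XY(2) Q(1,2) m])
  have "is_epi C X I e"
  proof (rule is_epiI[OF XY(1) I(1) e(1)])
    fix W u assume W: "W \<in> Obj C" "u \<in> Hom C I W" "u \<cdot> e = zero_mor C X W"
    obtain K \<kappa> where \<kappa>: "is_kernel C I W u K \<kappa>" using kernel_exists[OF I(1) W(1,2)] by blast
    then have K: "K \<in> Obj C" "\<kappa> \<in> Hom C K I" "u \<cdot> \<kappa> = zero_mor C K W" by (auto simp: is_kernel_def)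
    obtain e' where e': "e' \<in> Hom C X K" "\<kappa> \<cdot> e' = e"
      using \<kappa> XY(1) e(1) W(3) unfolding is_kernel_def by metis
    have m\<kappa>: "m \<cdot> \<kappa> \<in> Hom C K Y" by (rule cmp_closed[OF K(1) I(1) XY(2) K(2) I(2)])
    have "is_mono C K Y (m \<cdot> \<kappa>)"
      by (rule mono_cmp[OF K(1) I(1) XY(2) kernel_is_mono[OF I(1) W(1,2) \<kappa>] mono])
    \<comment> \<open>Here monomorphisms must be kernels. The map \<open>v\<close> kills
      \<open>f\<close>, hence factors through \<open>c\<close>, hence kills \<open>m\<close>; so
      \<open>m\<close> factors as \<open>m \<cdot> \<kappa> \<cdot> t\<close>, and cancelling
      \<open>m\<close> makes \<open>t\<close> a right inverse of \<kappa>.\<close>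
    then obtain Z v where Z: "Z \<in> Obj C" "v \<in> Hom C Y Z" and v: "is_kernel C Y Z v K (m \<cdot> \<kappa>)"
      using mono_is_kernel[OF K(1) XY(2)] by blast
    have "v \<cdot> f = v \<cdot> ((m \<cdot> \<kappa>) \<cdot> e')"
      using cmp_assoc[OF XY(1) K(1) I(1) XY(2) e'(1) K(2) I(2)] e e' by simp
    also have "\<dots> = (v \<cdot> (m \<cdot> \<kappa>)) \<cdot> e'"
      using cmp_assoc[OF XY(1) K(1) XY(2) Z(1) e'(1) m\<kappa> Z(2)] by simp
    also have "\<dots> = zero_mor C X Z"
      using v cmp_zero_left[OF XY(1) K(1) Z(1) e'(1)] by (simp add: is_kernel_def)
    finally obtain v' where v': "v' \<in> Hom C Q Z" "v' \<cdot> c = v"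
      using c Z unfolding is_cokernel_def by metis
    have "v \<cdot> m = v' \<cdot> (c \<cdot> m)" using cmp_assoc[OF I(1) XY(2) Q(1) Z(1) I(2) Q(2) v'(1)] v' by simp
    also have "\<dots> = zero_mor C I Z" using cmp_zero_right[OF I(1) Q(1) Z(1) v'(1)] I(3) by simp
    finally obtain t where t: "t \<in> Hom C I K" "m \<cdot> \<kappa> \<cdot> t = m"
      using v I unfolding is_kernel_def by metis
    have \<kappa>t: "\<kappa> \<cdot> t \<in> Hom C I I" by (rule cmp_closed[OF I(1) K(1) I(1) t(1) K(2)])
    have "m \<cdot> (\<kappa> \<cdot> t) = m \<cdot> Id C I"
      using cmp_assoc[OF I(1) K(1) I(1) XY(2) t(1) K(2) I(2)] t(2) Id_right[OF I(1) XY(2) I(2)] by simp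
    then have "\<kappa> \<cdot> t = Id C I"
      using mono \<kappa>t Id_closed[OF I(1)] I(1) unfolding is_mono_def by blast
    then have "u = u \<cdot> (\<kappa> \<cdot> t)" using Id_right[OF I(1) W(1,2)] by simp
    also have "\<dots> = (u \<cdot> \<kappa>) \<cdot> t" using cmp_assoc[OF I(1) K(1) I(1) W(1) t(1) K(2) W(2)] by simp
    also have "\<dots> = zero_mor C I W" using cmp_zero_left[OF I(1) K(1) W(1) t(1)] K(3) by simp
    finally show "u = zero_mor C I W" .
  qed
  with that I(1) mono e(2) show ?thesis by blast
qed

section \<open>Subfunctors of representable functors\<close>

text \<open>Values of \<open>F\<close> in degrees below \<open>m\<close> are left unconstrained, so
  that the bound can be chosen freely; elsewhere default values have to be supplied for
  them.\<close>

definition hom_subfunctor :: "('k, 'r) ring_scheme \<Rightarrow> ('o, 'm, 'k, 'z) lin_category_scheme \<Rightarrow>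
    (int \<Rightarrow> 'o) \<Rightarrow> int \<Rightarrow> 'o \<Rightarrow> (int \<Rightarrow> 'm set) \<Rightarrow> bool" where
  "hom_subfunctor k C E m X F \<longleftrightarrow>
     (\<forall>j\<ge>m. submodule k (F j) (hom_space C (E (- j)) X)) \<and>
     (\<forall>j\<ge>m. \<forall>t\<ge>j. \<forall>x\<in>F j. \<forall>a\<in>Hom C (E (- t)) (E (- j)). x \<cdot>\<^bsub>C\<^esub> a \<in> F t)"

text \<open>With \<open>G\<close> a subfunctor this says that \<open>G\<close> is noetherian. Having
  \<open>G\<close> as a parameter allows \<open>Hom(-, X)\<close> to be exhausted from the zero
  subfunctor in finitely many steps.\<close>

definition acc_hom_subfunctors :: "('k, 'r) ring_scheme \<Rightarrow> ('o, 'm, 'k, 'z) lin_category_scheme \<Rightarrow>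
    (int \<Rightarrow> 'o) \<Rightarrow> int \<Rightarrow> 'o \<Rightarrow> (int \<Rightarrow> 'm set) \<Rightarrow> bool" where
  "acc_hom_subfunctors k C E m X G \<longleftrightarrow> (\<forall>F. (\<forall>n::nat. hom_subfunctor k C E m X (F n)) \<longrightarrow>
     (\<forall>n. \<forall>j\<ge>m. F n j \<subseteq> F (Suc n) j) \<longrightarrow> (\<forall>n. \<forall>j\<ge>m. F n j \<subseteq> G j) \<longrightarrow>
     (\<exists>N. \<forall>n\<ge>N. \<forall>j\<ge>m. F n j \<subseteq> F N j))"

lemma hom_subfunctor_submodule:
  "\<lbrakk>hom_subfunctor k C E m X F; m \<le> j\<rbrakk> \<Longrightarrow> submodule k (F j) (hom_space C (E (- j)) X)"
  by (simp add: hom_subfunctor_def)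

lemma hom_subfunctor_closed:
  "\<lbrakk>hom_subfunctor k C E m X F; m \<le> j; j \<le> t; x \<in> F j; a \<in> Hom C (E (- t)) (E (- j))\<rbrakk>
    \<Longrightarrow> x \<cdot>\<^bsub>C\<^esub> a \<in> F t"
  by (simp add: hom_subfunctor_def)

lemma acc_hom_subfunctorsD:
  assumes "acc_hom_subfunctors k C E m X G" "\<And>n::nat. hom_subfunctor k C E m X (F n)"
    "\<And>n j. m \<le> j \<Longrightarrow> F n j \<subseteq> F (Suc n) j" "\<And>n j. m \<le> j \<Longrightarrow> F n j \<subseteq> G j"
  obtains N where "\<And>n j. \<lbrakk>N \<le> n; m \<le> j\<rbrakk> \<Longrightarrow> F n j \<subseteq> F N j"
  using assms unfolding acc_hom_subfunctors_def by metis

context linear_category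
begin

lemma submodule_hom_space_iff:
  assumes "X \<in> Obj C" "Y \<in> Obj C"
  shows "submodule k U (hom_space C X Y) \<longleftrightarrow> U \<subseteq> Hom C X Y \<and> zero_mor C X Y \<in> U \<and>
    (\<forall>x\<in>U. \<forall>y\<in>U. add_mor C x y \<in> U) \<and> (\<forall>c\<in>carrier k. \<forall>x\<in>U. smul_mor C c x \<in> U)"
  using hom_module[OF assms] unfolding submodule_def by auto

lemma submodule_zero_mor:
  assumes "X \<in> Obj C" "Y \<in> Obj C"
  shows "submodule k {zero_mor C X Y} (hom_space C X Y)"
proof -
  interpret V: module k "hom_space C X Y" by (rule hom_module[OF assms])
  show ?thesis using V.smult_r_null V.l_zero[of "zero_mor C X Y"] V.zero_closed
    by (simp add: submodule_hom_space_iff[OF assms])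
qed

text \<open>In the truncated algebra the components from \<open>j\<close> to \<open>t < j\<close>
  are zero. Hence \<open>proj_module\<close> vanishes in degrees below \<open>i\<close>, where a
  submodule has no choice, and only the action of morphisms with \<open>j \<le> t\<close> gives a
  closure condition.\<close>

lemma graded_submodule_proj_module_iff:
  assumes E: "\<And>i. E i \<in> Obj C"
  shows "graded_submodule k (zalg_nonneg (zalg_of C E)) (proj_module (zalg_nonneg (zalg_of C E)) i) F \<longleftrightarrow>
    hom_subfunctor k C E i (E (- i)) F \<and> (\<forall>j<i. F j = {zero_mor C (E (- j)) (E (- i))})"
    (is "graded_submodule k ?A ?P F \<longleftrightarrow> ?R")
proof -
  have P: "graded_right_module k ?A ?P"
    using proj_module_in_GrMod[OF zalgebra_zalg_nonneg[OF zalgebra_zalg_of[OF E]]] by (simp add: GrMod_def)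
  have sm_ge: "submodule k U (gcomp ?P j) \<longleftrightarrow> submodule k U (hom_space C (E (- j)) (E (- i)))"
    if "i \<le> j" for U j
    using that by (simp add: proj_module_def zalg_nonneg_def zalg_of_def)
  have sm_lt: "submodule k U (gcomp ?P j) \<longleftrightarrow> U = {zero_mor C (E (- j)) (E (- i))}"
    if "j < i" for U j
  proof -
    have c: "carrier (gcomp ?P j) = {zero_mor C (E (- j)) (E (- i))}" "\<zero>\<^bsub>gcomp ?P j\<^esub> = zero_mor C (E (- j)) (E (- i))"
      using that by (simp_all add: proj_module_def zalg_nonneg_def zalg_of_def)
    have m: "module k (gcomp ?P j)"
      using P by (auto simp: graded_right_module_def intro: vectorspace.axioms(1))
    interpret M: module k "gcomp ?P j" by (rule m)
    show ?thesis
    proof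
      assume "submodule k U (gcomp ?P j)"
      then show "U = {zero_mor C (E (- j)) (E (- i))}"
        using submodule.subset[of k U "gcomp ?P j"] submodule.zero_closed[of k U "gcomp ?P j"] c by auto
    next
      assume "U = {zero_mor C (E (- j)) (E (- i))}"
      then have U: "U = {\<zero>\<^bsub>gcomp ?P j\<^esub>}" by (simp add: c)
      show "submodule k U (gcomp ?P j)"
        unfolding U by (rule submodule.intro[OF m]) auto
    qed
  qed
  have carA: "carrier (zcomp ?A j t) = (if j \<le> t then Hom C (E (- t)) (E (- j)) else {zero_mor C (E (- t)) (E (- j))})" for j t
    by (simp add: zalg_nonneg_def zalg_of_def)
  have act: "gact ?P j t x a = x \<cdot> a" for j t x a
    by (simp add: proj_module_def zalg_nonneg_def zalg_of_def)
  show ?thesis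
  proof
    assume F: "graded_submodule k ?A ?P F"
    show ?R unfolding hom_subfunctor_def
    proof (intro conjI allI impI ballI)
      fix j assume "i \<le> j"
      then show "submodule k (F j) (hom_space C (E (- j)) (E (- i)))"
        using F sm_ge[of j "F j"] unfolding graded_submodule_def by blast
    next
      fix j t x a assume "i \<le> j" "j \<le> t" "x \<in> F j" "a \<in> Hom C (E (- t)) (E (- j))"
      then show "x \<cdot> a \<in> F t" using F carA[of j t] unfolding graded_submodule_def act by auto
    next
      fix j assume "j < i"
      then show "F j = {zero_mor C (E (- j)) (E (- i))}"
        using F sm_lt[of j "F j"] unfolding graded_submodule_def by blast
    qed
  next
    assume R: ?R
    then have sm: "submodule k (F j) (hom_space C (E (- j)) (E (- i)))" for j
      using submodule_zero_mor[OF E E] by (cases "i \<le> j") (simp_all add: hom_subfunctor_def)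
    then have zF: "zero_mor C (E (- j)) (E (- i)) \<in> F j" and FH: "F j \<subseteq> Hom C (E (- j)) (E (- i))" for j
      by (simp_all add: submodule_hom_space_iff[OF E E])
    show "graded_submodule k ?A ?P F"
      unfolding graded_submodule_def act
    proof (intro conjI allI ballI)
      show "submodule k (F j) (gcomp ?P j)" for j
        using sm[of j] R sm_ge[of j] sm_lt[of j] by (cases "i \<le> j") auto
      fix j t x a assume x: "x \<in> F j" and a: "a \<in> carrier (zcomp ?A j t)"
      have xH: "x \<in> Hom C (E (- j)) (E (- i))" using x FH by blast
      have aH: "a \<in> Hom C (E (- t)) (E (- j))"
        using a zero_mor_closed[OF E E] by (auto simp: carA split: if_splits)
      consider "j < i" | "t < j" | "i \<le> j" "j \<le> t" by linarith
      then show "x \<cdot> a \<in> F t"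
      proof cases
        case 1
        then show ?thesis using R x cmp_zero_left[OF E E E aH] zF by simp
      next
        case 2
        then show ?thesis using a cmp_zero_right[OF E E E xH] zF by (simp add: carA)
      next
        case 3
        then show ?thesis using R x aH by (auto simp: hom_subfunctor_def)
      qed
    qed
  qed
qed

lemma right_noetherian_zalg_iff:
  assumes E: "\<And>i. E i \<in> Obj C"
  shows "right_noetherian k (zalg_nonneg (zalg_of C E)) \<longleftrightarrow>
    (\<forall>i. acc_hom_subfunctors k C E i (E (- i)) (\<lambda>j. Hom C (E (- j)) (E (- i))))"
proof -
  let ?A = "zalg_nonneg (zalg_of C E)"
  have P: "graded_right_module k ?A (proj_module ?A i)" for i
    using proj_module_in_GrMod[OF zalgebra_zalg_nonneg[OF zalgebra_zalg_of[OF E]]] by (simp add: GrMod_def)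
  have "noetherian_object (GrMod k ?A) (proj_module ?A i) \<longleftrightarrow>
    acc_hom_subfunctors k C E i (E (- i)) (\<lambda>j. Hom C (E (- j)) (E (- i)))" for i
    unfolding noetherian_object_GrMod_iff[OF P] graded_submodule_proj_module_iff[OF E]
  proof (intro iffI allI impI)
    assume L: "\<forall>F. (\<forall>n::nat. hom_subfunctor k C E i (E (- i)) (F n) \<and>
        (\<forall>j<i. F n j = {zero_mor C (E (- j)) (E (- i))})) \<and> (\<forall>n j. F n j \<subseteq> F (Suc n) j)
        \<longrightarrow> (\<exists>N. \<forall>n\<ge>N. \<forall>j. F n j \<subseteq> F N j)"
    show "acc_hom_subfunctors k C E i (E (- i)) (\<lambda>j. Hom C (E (- j)) (E (- i)))"
      unfolding acc_hom_subfunctors_def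
    proof (intro allI impI)
      fix F :: "nat \<Rightarrow> _"
      assume F: "\<forall>n. hom_subfunctor k C E i (E (- i)) (F n)" "\<forall>n. \<forall>j\<ge>i. F n j \<subseteq> F (Suc n) j"
      \<comment> \<open>\<open>F\<close> is arbitrary below \<open>i\<close>, while a graded
        submodule must be zero there, so \<open>F\<close> is overwritten in those degrees.\<close>
      define F' where "F' n j = (if i \<le> j then F n j else {zero_mor C (E (- j)) (E (- i))})" for n j
      have "hom_subfunctor k C E i (E (- i)) (F' n)" for n
        using F(1) by (simp add: hom_subfunctor_def F'_def)
      moreover have "\<forall>n j. F' n j \<subseteq> F' (Suc n) j" using F(2) by (simp add: F'_def)
      moreover have "\<forall>n. \<forall>j<i. F' n j = {zero_mor C (E (- j)) (E (- i))}" by (simp add: F'_def)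
      ultimately have "\<exists>N. \<forall>n\<ge>N. \<forall>j. F' n j \<subseteq> F' N j" by (intro L[rule_format]) simp
      then obtain N where N: "\<And>n j. n \<ge> N \<Longrightarrow> F' n j \<subseteq> F' N j" by blast
      have "F n j \<subseteq> F N j" if "n \<ge> N" "j \<ge> i" for n j
        using N[of n j] that by (simp add: F'_def)
      then show "\<exists>N. \<forall>n\<ge>N. \<forall>j\<ge>i. F n j \<subseteq> F N j" by blast
    qed
  next
    fix F :: "nat \<Rightarrow> _"
    assume R: "acc_hom_subfunctors k C E i (E (- i)) (\<lambda>j. Hom C (E (- j)) (E (- i)))"
      and F: "(\<forall>n. hom_subfunctor k C E i (E (- i)) (F n) \<and>
        (\<forall>j<i. F n j = {zero_mor C (E (- j)) (E (- i))})) \<and> (\<forall>n j. F n j \<subseteq> F (Suc n) j)"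
    obtain N where N: "\<And>n j. \<lbrakk>N \<le> n; i \<le> j\<rbrakk> \<Longrightarrow> F n j \<subseteq> F N j"
    proof (rule acc_hom_subfunctorsD[OF R])
      show "hom_subfunctor k C E i (E (- i)) (F n)" for n using F by blast
      then show "i \<le> j \<Longrightarrow> F n j \<subseteq> Hom C (E (- j)) (E (- i))" for n j
        using submodule_hom_space_iff[OF E E] by (simp add: hom_subfunctor_def)
      show "F n j \<subseteq> F (Suc n) j" for n j using F by blast
    qed (rule that)
    have "F n j \<subseteq> F N j" if "N \<le> n" for n j
      using F N[OF that, of j] by (cases "i \<le> j") auto
    then show "\<exists>N. \<forall>n\<ge>N. \<forall>j. F n j \<subseteq> F N j" by blast
  qed
  then show ?thesis by (simp add: right_noetherian_def)
qed

end

section \<open>Calculus of subfunctors, and their extension by one generator\<close>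

context linear_category
begin

lemma hom_subfunctor_subset:
  assumes "\<And>i. E i \<in> Obj C" "X \<in> Obj C" "hom_subfunctor k C E m X F" "m \<le> j"
  shows "F j \<subseteq> Hom C (E (- j)) X"
  using hom_subfunctor_submodule[OF assms(3,4)] by (simp add: submodule_hom_space_iff assms)

lemma hom_subfunctor_zero:
  assumes "\<And>i. E i \<in> Obj C" "X \<in> Obj C" "hom_subfunctor k C E m X F" "m \<le> j"
  shows "zero_mor C (E (- j)) X \<in> F j"
  using hom_subfunctor_submodule[OF assms(3,4)] by (simp add: submodule_hom_space_iff assms)

lemma hom_subfunctor_add:
  assumes "\<And>i. E i \<in> Obj C" "X \<in> Obj C" "hom_subfunctor k C E m X F" "m \<le> j" "x \<in> F j" "y \<in> F j"
  shows "add_mor C x y \<in> F j"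
  using hom_subfunctor_submodule[OF assms(3,4)] assms by (simp add: submodule_hom_space_iff)

lemma hom_subfunctor_smul:
  assumes "\<And>i. E i \<in> Obj C" "X \<in> Obj C" "hom_subfunctor k C E m X F" "m \<le> j" "x \<in> F j" "c \<in> carrier k"
  shows "smul_mor C c x \<in> F j"
  using hom_subfunctor_submodule[OF assms(3,4)] assms by (simp add: submodule_hom_space_iff)

lemma hom_subfunctor_diff:
  assumes E: "\<And>i. E i \<in> Obj C" and X: "X \<in> Obj C" and F: "hom_subfunctor k C E m X F" "m \<le> j"
    and xy: "x \<in> F j" "y \<in> F j"
  shows "x \<ominus>\<^bsub>hom_space C (E (- j)) X\<^esub> y \<in> F j"
proof -
  interpret V: module k "hom_space C (E (- j)) X" by (rule hom_module[OF E X])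
  have y: "y \<in> carrier (hom_space C (E (- j)) X)" using hom_subfunctor_subset[OF E X F] xy by auto
  have "\<ominus>\<^bsub>hom_space C (E (- j)) X\<^esub> y = smul_mor C (\<ominus>\<^bsub>k\<^esub> \<one>\<^bsub>k\<^esub>) y"
    using V.smult_l_minus[OF _ y, of "\<one>\<^bsub>k\<^esub>"] V.smult_one[OF y] by simp
  moreover have "smul_mor C (\<ominus>\<^bsub>k\<^esub> \<one>\<^bsub>k\<^esub>) y \<in> F j" by (rule hom_subfunctor_smul[OF E X F xy(2)]) simp
  ultimately show ?thesis using hom_subfunctor_add[OF E X F xy(1)] by (simp add: a_minus_def)
qed

lemma hom_subfunctor_Int:
  assumes E: "\<And>i. E i \<in> Obj C" and X: "X \<in> Obj C"
    and F: "hom_subfunctor k C E m X F" and G: "hom_subfunctor k C E m X G"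
  shows "hom_subfunctor k C E m X (\<lambda>j. F j \<inter> G j)"
  using F G by (auto simp: hom_subfunctor_def submodule_hom_space_iff E X)

text \<open>The usual argument that an extension of noetherian modules is noetherian: \<open>F n\<close> is controlled
  by \<open>F n \<inter> G\<close> and by the \<open>g\<close> for which \<open>p \<cdot> g\<close> occurs in \<open>F n\<close> modulo \<open>G\<close>.\<close>

lemma hom_subfunctor_extend:
  fixes E :: "int \<Rightarrow> 'o" and G :: "int \<Rightarrow> 'm set"
  assumes E: "\<And>i. E i \<in> Obj C" and X: "X \<in> Obj C" and p: "p \<in> Hom C (E (- i)) X" and im: "i \<le> m"
    and G: "hom_subfunctor k C E m X G" and accG: "acc_hom_subfunctors k C E m X G"
    and acci: "acc_hom_subfunctors k C E i (E (- i)) (\<lambda>j. Hom C (E (- j)) (E (- i)))"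
  defines "G' \<equiv> \<lambda>j. {add_mor C b (p \<cdot> g) | b g. b \<in> G j \<and> g \<in> Hom C (E (- j)) (E (- i))}"
  shows "hom_subfunctor k C E m X G'" "acc_hom_subfunctors k C E m X G'"
proof -
  note GH = hom_subfunctor_subset[OF E X G, THEN subsetD]
  have pg: "p \<cdot> g \<in> Hom C (E (- j)) X" if "g \<in> Hom C (E (- j)) (E (- i))" for j g
    by (rule cmp_closed[OF E E X that p])
  \<comment> \<open>Together with \<open>smul\<close> and \<open>comp\<close> below, this says that
    sending \<open>(b, g)\<close> to \<open>b + p \<cdot> g\<close> is linear and natural in
    \<open>E (- j)\<close>. The closure properties of \<open>G'\<close>, and later of
    \<open>L\<close>, rest on it.\<close>
  have exch: "add_mor C (add_mor C b b') (p \<cdot> add_mor C g g') =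
      add_mor C (add_mor C b (p \<cdot> g)) (add_mor C b' (p \<cdot> g'))"
    if "b \<in> Hom C (E (- j)) X" "b' \<in> Hom C (E (- j)) X"
      "g \<in> Hom C (E (- j)) (E (- i))" "g' \<in> Hom C (E (- j)) (E (- i))" for b b' g g' j
  proof -
    interpret V: module k "hom_space C (E (- j)) X" by (rule hom_module[OF E X])
    show ?thesis using V.a_ac[simplified] that pg cmp_add_right[OF E E X that(3,4) p] V.a_closed by simp
  qed
  have smul: "add_mor C (smul_mor C c b) (p \<cdot> smul_mor C c g) = smul_mor C c (add_mor C b (p \<cdot> g))"
    if "b \<in> Hom C (E (- j)) X" "g \<in> Hom C (E (- j)) (E (- i))" "c \<in> carrier k" for b c g j
  proof -
    interpret V: module k "hom_space C (E (- j)) X" by (rule hom_module[OF E X])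
    show ?thesis using V.smult_r_distr[of c b "p \<cdot> g"] that pg cmp_smul_right[OF E E X that(2) p that(3)] by simp
  qed
  have smul_closed: "smul_mor C c f \<in> Hom C Y Z" if "Y \<in> Obj C" "Z \<in> Obj C" "f \<in> Hom C Y Z" "c \<in> carrier k" for c f Y Z
  proof -
    interpret V: module k "hom_space C Y Z" by (rule hom_module[OF that(1,2)])
    show ?thesis using V.smult_closed[of c f] that by simp
  qed
  have comp: "add_mor C b (p \<cdot> g) \<cdot> a = add_mor C (b \<cdot> a) (p \<cdot> (g \<cdot> a))"
    if "b \<in> Hom C (E (- j)) X" "g \<in> Hom C (E (- j)) (E (- i))" "a \<in> Hom C (E (- t)) (E (- j))" for b g a j t
    using cmp_add_left[OF E E X that(3,1) pg[OF that(2)]] cmp_assoc[OF E E E X that(3,2) p] by simp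
  show G': "hom_subfunctor k C E m X G'"
    unfolding hom_subfunctor_def
  proof (intro conjI allI impI ballI)
    fix j assume j: "m \<le> j"
    have "zero_mor C (E (- j)) X = add_mor C (zero_mor C (E (- j)) X) (p \<cdot> zero_mor C (E (- j)) (E (- i)))"
      by (simp add: cmp_zero_right[OF E E X p] add_zero_left[OF E X zero_mor_closed[OF E X]])
    then have "zero_mor C (E (- j)) X \<in> G' j"
      unfolding G'_def using zero_mor_closed[OF E E] hom_subfunctor_zero[OF E X G j] by blast
    moreover have "add_mor C x y \<in> G' j" if xy: "x \<in> G' j" "y \<in> G' j" for x y
    proof -
      obtain b g where x: "x = add_mor C b (p \<cdot> g)" "b \<in> G j" "g \<in> Hom C (E (- j)) (E (- i))"
        using xy unfolding G'_def by blast
      obtain b' g' where y: "y = add_mor C b' (p \<cdot> g')" "b' \<in> G j" "g' \<in> Hom C (E (- j)) (E (- i))"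
        using xy unfolding G'_def by blast
      have "add_mor C x y = add_mor C (add_mor C b b') (p \<cdot> add_mor C g g')"
        using exch[OF GH[OF j x(2)] GH[OF j y(2)] x(3) y(3)] x y by simp
      then show ?thesis
        using hom_subfunctor_add[OF E X G j x(2) y(2)] add_mor_closed[OF E E x(3) y(3)]
        unfolding G'_def by blast
    qed
    moreover have "smul_mor C c x \<in> G' j" if c: "c \<in> carrier k" and x: "x \<in> G' j" for c x
    proof -
      obtain b g where x: "x = add_mor C b (p \<cdot> g)" "b \<in> G j" "g \<in> Hom C (E (- j)) (E (- i))"
        using x unfolding G'_def by blast
      have "smul_mor C c x = add_mor C (smul_mor C c b) (p \<cdot> smul_mor C c g)"
        using smul[OF GH[OF j x(2)] x(3) c] x by simp
      then show ?thesis
        using hom_subfunctor_smul[OF E X G j x(2) c] smul_closed[OF E E x(3) c]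
        unfolding G'_def by blast
    qed
    moreover have "G' j \<subseteq> Hom C (E (- j)) X"
      unfolding G'_def using add_mor_closed[OF E X GH[OF j] pg] by blast
    ultimately show "submodule k (G' j) (hom_space C (E (- j)) X)"
      by (simp add: submodule_hom_space_iff[OF E X])
  next
    fix j t x a assume jt: "m \<le> j" "j \<le> t" and x: "x \<in> G' j" and a: "a \<in> Hom C (E (- t)) (E (- j))"
    obtain b g where x: "x = add_mor C b (p \<cdot> g)" "b \<in> G j" "g \<in> Hom C (E (- j)) (E (- i))"
      using x unfolding G'_def by blast
    have "x \<cdot> a = add_mor C (b \<cdot> a) (p \<cdot> (g \<cdot> a))"
      using comp[OF GH[OF jt(1) x(2)] x(3) a] x by simp
    then show "x \<cdot> a \<in> G' t"
      using hom_subfunctor_closed[OF G jt x(2) a] cmp_closed[OF E E E a x(3)] unfolding G'_def by blast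
  qed
  show "acc_hom_subfunctors k C E m X G'"
    unfolding acc_hom_subfunctors_def
  proof (intro allI impI)
    fix F :: "nat \<Rightarrow> int \<Rightarrow> 'm set"
    assume "\<forall>n. hom_subfunctor k C E m X (F n)" "\<forall>n. \<forall>j\<ge>m. F n j \<subseteq> F (Suc n) j"
      "\<forall>n. \<forall>j\<ge>m. F n j \<subseteq> G' j"
    then have F: "\<And>n. hom_subfunctor k C E m X (F n)" and inc: "\<And>n j. m \<le> j \<Longrightarrow> F n j \<subseteq> F (Suc n) j"
      and FG: "\<And>n j. m \<le> j \<Longrightarrow> F n j \<subseteq> G' j" by auto
    have mono: "F n j \<subseteq> F n' j" if "n \<le> n'" "m \<le> j" for n n' j
      using lift_Suc_mono_le[of "\<lambda>n. F n j", OF inc[OF that(2)] that(1)] .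
    note FH = hom_subfunctor_subset[OF E X F, THEN subsetD]
    obtain N1 where N1: "\<And>n j. \<lbrakk>N1 \<le> n; m \<le> j\<rbrakk> \<Longrightarrow> F n j \<inter> G j \<subseteq> F N1 j \<inter> G j"
    proof (rule acc_hom_subfunctorsD[OF accG])
      show "hom_subfunctor k C E m X (\<lambda>j. F n j \<inter> G j)" for n
        by (rule hom_subfunctor_Int[OF E X F G])
      show "F n j \<inter> G j \<subseteq> F (Suc n) j \<inter> G j" if "m \<le> j" for n j using inc[OF that] by auto
      show "F n j \<inter> G j \<subseteq> G j" for n j by simp
    qed (rule that)
    \<comment> \<open>The hypothesis \<open>acci\<close> concerns subfunctors from degree
      \<open>i\<close> on, whereas \<open>F n\<close> and \<open>G\<close> are controlled only from
      \<open>m \<ge> i\<close> on. The gap is filled with zero, which is harmless: the multiples of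
      zero are zero, and zero lies in every \<open>L n t\<close>.\<close>
    define L where "L n j = (if m \<le> j then {g \<in> Hom C (E (- j)) (E (- i)). \<exists>b\<in>G j. add_mor C b (p \<cdot> g) \<in> F n j}
      else {zero_mor C (E (- j)) (E (- i))})" for n j
    have LH: "L n j \<subseteq> Hom C (E (- j)) (E (- i))" for n j
      using zero_mor_closed[OF E E] by (simp add: L_def)
    have L: "hom_subfunctor k C E i (E (- i)) (L n)" for n
      unfolding hom_subfunctor_def
    proof (intro conjI allI impI ballI)
      fix j assume "i \<le> j"
      show "submodule k (L n j) (hom_space C (E (- j)) (E (- i)))"
      proof (cases "m \<le> j")
        case False
        then show ?thesis using submodule_zero_mor[OF E E] by (simp add: L_def)
      next
        case j: True
        have "add_mor C (zero_mor C (E (- j)) X) (p \<cdot> zero_mor C (E (- j)) (E (- i))) \<in> F n j"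
          using hom_subfunctor_zero[OF E X F j]
          by (simp add: cmp_zero_right[OF E E X p] add_zero_left[OF E X zero_mor_closed[OF E X]])
        then have "zero_mor C (E (- j)) (E (- i)) \<in> L n j"
          using j zero_mor_closed[OF E E] hom_subfunctor_zero[OF E X G j] by (auto simp: L_def)
        moreover have "add_mor C g g' \<in> L n j" if "g \<in> L n j" "g' \<in> L n j" for g g'
        proof -
          from that j obtain b b' where b: "g \<in> Hom C (E (- j)) (E (- i))" "b \<in> G j" "add_mor C b (p \<cdot> g) \<in> F n j"
            and b': "g' \<in> Hom C (E (- j)) (E (- i))" "b' \<in> G j" "add_mor C b' (p \<cdot> g') \<in> F n j"
            by (auto simp: L_def)
          have "add_mor C (add_mor C b b') (p \<cdot> add_mor C g g') \<in> F n j"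
            using exch[OF GH[OF j b(2)] GH[OF j b'(2)] b(1) b'(1)] hom_subfunctor_add[OF E X F j b(3) b'(3)] by simp
          then show ?thesis
            using j add_mor_closed[OF E E b(1) b'(1)] hom_subfunctor_add[OF E X G j b(2) b'(2)]
            by (auto simp: L_def)
        qed
        moreover have "smul_mor C c g \<in> L n j" if "c \<in> carrier k" "g \<in> L n j" for c g
        proof -
          from that j obtain b where b: "g \<in> Hom C (E (- j)) (E (- i))" "b \<in> G j" "add_mor C b (p \<cdot> g) \<in> F n j"
            by (auto simp: L_def)
          have "add_mor C (smul_mor C c b) (p \<cdot> smul_mor C c g) \<in> F n j"
            using smul[OF GH[OF j b(2)] b(1) that(1)] hom_subfunctor_smul[OF E X F j b(3) that(1)] by simp
          then show ?thesis
            using j smul_closed[OF E E b(1) that(1)] hom_subfunctor_smul[OF E X G j b(2) that(1)]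
            by (auto simp: L_def)
        qed
        ultimately show ?thesis using LH by (simp add: submodule_hom_space_iff[OF E E])
      qed
    next
      fix j t g a assume jt: "i \<le> j" "j \<le> t" and g: "g \<in> L n j" and a: "a \<in> Hom C (E (- t)) (E (- j))"
      show "g \<cdot> a \<in> L n t"
      proof (cases "m \<le> j")
        case j: True
        then obtain b where b: "g \<in> Hom C (E (- j)) (E (- i))" "b \<in> G j" "add_mor C b (p \<cdot> g) \<in> F n j"
          using g by (auto simp: L_def)
        have "add_mor C (b \<cdot> a) (p \<cdot> (g \<cdot> a)) \<in> F n t"
          using comp[OF GH[OF j b(2)] b(1) a] hom_subfunctor_closed[OF F j jt(2) b(3) a] by simp
        then show ?thesis
          using j jt cmp_closed[OF E E E a b(1)] hom_subfunctor_closed[OF G j jt(2) b(2) a]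
          by (auto simp: L_def)
      next
        case False
        then have ga: "g \<cdot> a = zero_mor C (E (- t)) (E (- i))"
          using g cmp_zero_left[OF E E E a] by (simp add: L_def)
        show ?thesis
        proof (cases "m \<le> t")
          case t: True
          have "add_mor C (zero_mor C (E (- t)) X) (p \<cdot> zero_mor C (E (- t)) (E (- i))) \<in> F n t"
            using hom_subfunctor_zero[OF E X F t]
            by (simp add: cmp_zero_right[OF E E X p] add_zero_left[OF E X zero_mor_closed[OF E X]])
          then show ?thesis
            using t zero_mor_closed[OF E E] hom_subfunctor_zero[OF E X G t] by (auto simp: L_def ga)
        qed (simp add: L_def ga)
      qed
    qed
    obtain N2 where N2: "\<And>n j. \<lbrakk>N2 \<le> n; i \<le> j\<rbrakk> \<Longrightarrow> L n j \<subseteq> L N2 j"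
    proof (rule acc_hom_subfunctorsD[where F = L, OF acci])
      show "L n j \<subseteq> L (Suc n) j" for n j using inc[of j n] by (auto simp: L_def)
      show "hom_subfunctor k C E i (E (- i)) (L n)" for n by (rule L)
      show "L n j \<subseteq> Hom C (E (- j)) (E (- i))" for n j by (rule LH)
    qed (rule that)
    define N where "N = max N1 N2"
    have "x \<in> F N j" if n: "n \<ge> N" and j: "m \<le> j" and x: "x \<in> F n j" for n j x
    proof -
      interpret V: module k "hom_space C (E (- j)) X" by (rule hom_module[OF E X])
      obtain b g where bg: "x = add_mor C b (p \<cdot> g)" "b \<in> G j" "g \<in> Hom C (E (- j)) (E (- i))"
        using FG[OF j] x unfolding G'_def by blast
      then have "g \<in> L n j" using x j by (auto simp: L_def)
      then have "g \<in> L N2 j" using N2[of n j] n j im by (auto simp: N_def)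
      \<comment> \<open>The same \<open>g\<close> already occurs in \<open>F N2\<close>, possibly
        with another correction \<open>b'\<close>. Then \<open>x\<close> and \<open>y\<close> differ
        by \<open>b - b'\<close>, which lies both in \<open>G j\<close> and in \<open>F n j\<close>,
        so that \<open>N1\<close> applies to the difference.\<close>
      then obtain b' where b': "b' \<in> G j" "add_mor C b' (p \<cdot> g) \<in> F N2 j" using j by (auto simp: L_def)
      define y where "y = add_mor C b' (p \<cdot> g)"
      have yN: "y \<in> F N j" using b' mono[of N2 N j] j by (auto simp: y_def N_def)
      have yn: "y \<in> F n j" using yN mono[OF n j] by blast
      define d where "d = x \<ominus>\<^bsub>hom_space C (E (- j)) X\<^esub> y"
      have car: "b \<in> carrier (hom_space C (E (- j)) X)" "b' \<in> carrier (hom_space C (E (- j)) X)"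
        "p \<cdot> g \<in> carrier (hom_space C (E (- j)) X)"
        using GH[OF j] bg b' pg by auto
      have "d = b \<ominus>\<^bsub>hom_space C (E (- j)) X\<^esub> b'"
        using V.add_minus_add_right[OF car] by (simp add: d_def y_def bg(1))
      then have "d \<in> G j" using hom_subfunctor_diff[OF E X G j bg(2) b'(1)] by simp
      moreover have "d \<in> F n j" unfolding d_def by (rule hom_subfunctor_diff[OF E X F j x yn])
      ultimately have "d \<in> F N1 j" using N1[of n j] n j by (auto simp: N_def)
      then have dN: "d \<in> F N j" using mono[of N1 N j] j by (auto simp: N_def)
      have "x = add_mor C d y"
      proof -
        have "x \<in> carrier (hom_space C (E (- j)) X)" "y \<in> carrier (hom_space C (E (- j)) X)"
          using FH[OF j] x yn by auto
        then show ?thesis using V.minus_add_cancel[of x y] by (simp add: d_def)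
      qed
      then show ?thesis using hom_subfunctor_add[OF E X F j dN yN] by simp
    qed
    then show "\<exists>N. \<forall>n\<ge>N. \<forall>j\<ge>m. F n j \<subseteq> F N j" by blast
  qed
qed

end

section \<open>Ample sequences\<close>

locale ample_sequence = abelian_category k C
  for k :: "('k, 'r) ring_scheme" and C :: "('o, 'm, 'k, 'z) lin_category_scheme" (structure) +
  fixes E :: "int \<Rightarrow> 'o"
  assumes ample: "ample C E"
begin

lemma E_Obj: "E i \<in> Obj C"
  using ample by (simp add: ample_def)

lemma ample_cover:
  assumes "X \<in> Obj C"
  obtains js S \<iota> \<pi> where "\<And>i. i \<in> set js \<Longrightarrow> m \<le> i"
    "is_coproduct C (map (\<lambda>i. E (- i)) js) S \<iota>" "is_epi C S X \<pi>"
  using ample assms unfolding ample_def by meson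

lemma ample_lift:
  assumes "X \<in> Obj C" "Y \<in> Obj C" "is_epi C X Y f"
  obtains m where "\<And>i h. \<lbrakk>m \<le> i; h \<in> Hom C (E (- i)) Y\<rbrakk> \<Longrightarrow> \<exists>h'\<in>Hom C (E (- i)) X. h = f \<cdot> h'"
proof -
  obtain m where "\<forall>i\<ge>m. (\<lambda>h. f \<cdot> h) ` Hom C (E (- i)) X = Hom C (E (- i)) Y"
    using ample assms unfolding ample_def by blast
  then show thesis using that[of m] by blast
qed

lemma coproduct_ex1:
  assumes "is_coproduct C (map (\<lambda>i. E (- i)) js) S \<iota>" "W \<in> Obj C"
    and "\<And>s. s < length js \<Longrightarrow> g s \<in> Hom C (E (- (js ! s))) W"
  shows "\<exists>!h. h \<in> Hom C S W \<and> (\<forall>s<length js. h \<cdot> \<iota> s = g s)"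
  using assms by (simp add: is_coproduct_def)

text \<open>A containment of the induced subfunctors in degrees at least \<open>m\<close> lifts back
  to subobjects. Cover \<open>S n\<close> by a finite sum \<open>T\<close> of objects
  \<open>E (- j)\<close> with \<open>j \<ge> m\<close>: each summand maps into \<open>S N\<close>
  over \<open>X\<close>, the resulting map from \<open>T\<close> descends along the cover, and this
  gives the factorisation.\<close>

lemma noetherian_object_if_acc:
  assumes X: "X \<in> Obj C" and acc: "acc_hom_subfunctors k C E m X (\<lambda>j. Hom C (E (- j)) X)"
  shows "noetherian_object C X"
  unfolding noetherian_object_def
proof (intro conjI allI impI X)
  fix S \<mu> assume "(\<forall>n::nat. S n \<in> Obj C \<and> is_mono C (S n) X (\<mu> n)) \<and>
    (\<forall>n. subobject_le C (S n) (\<mu> n) (S (Suc n)) (\<mu> (Suc n)))"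
  then have S: "\<And>n. S n \<in> Obj C" and mono: "\<And>n. is_mono C (S n) X (\<mu> n)"
    and le: "\<And>n. subobject_le C (S n) (\<mu> n) (S (Suc n)) (\<mu> (Suc n))" by auto
  have \<mu>: "\<mu> n \<in> Hom C (S n) X" for n using mono by (auto simp: is_mono_def)
  define F where "F n j = (\<lambda>h. \<mu> n \<cdot> h) ` Hom C (E (- j)) (S n)" for n j
  obtain N where N: "\<And>n j. \<lbrakk>N \<le> n; m \<le> j\<rbrakk> \<Longrightarrow> F n j \<subseteq> F N j"
  proof (rule acc_hom_subfunctorsD[OF acc])
    show "hom_subfunctor k C E m X (F n)" for n
      unfolding hom_subfunctor_def
    proof (intro conjI allI impI ballI)
      fix j
      interpret mod_hom k "hom_space C (E (- j)) (S n)" "hom_space C (E (- j)) X" "\<lambda>h. \<mu> n \<cdot> h"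
        by (rule postcomp_mod_hom[OF E_Obj S X \<mu>])
      show "submodule k (F n j) (hom_space C (E (- j)) X)"
        using im_is_submodule by (simp add: F_def im_def)
    next
      fix j t x a assume x: "x \<in> F n j" and a: "a \<in> Hom C (E (- t)) (E (- j))"
      then obtain h where h: "h \<in> Hom C (E (- j)) (S n)" "x = \<mu> n \<cdot> h" by (auto simp: F_def)
      then show "x \<cdot> a \<in> F n t"
        using cmp_assoc[OF E_Obj E_Obj S X a h(1) \<mu>] cmp_closed[OF E_Obj E_Obj S a h(1)] by (auto simp: F_def)
    qed
    show "F n j \<subseteq> F (Suc n) j" for n j
    proof
      fix x assume "x \<in> F n j"
      then obtain h where h: "h \<in> Hom C (E (- j)) (S n)" "x = \<mu> n \<cdot> h" by (auto simp: F_def)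
      obtain g where g: "g \<in> Hom C (S n) (S (Suc n))" "\<mu> (Suc n) \<cdot> g = \<mu> n"
        using le[of n] unfolding subobject_le_def by blast
      have "x = \<mu> (Suc n) \<cdot> (g \<cdot> h)" using cmp_assoc[OF E_Obj S S X h(1) g(1) \<mu>] g h by simp
      then show "x \<in> F (Suc n) j" using cmp_closed[OF E_Obj S S h(1) g(1)] by (auto simp: F_def)
    qed
    show "F n j \<subseteq> Hom C (E (- j)) X" for n j
      using cmp_closed[OF E_Obj S X _ \<mu>] by (auto simp: F_def)
  qed (rule that)
  have "subobject_le C (S n) (\<mu> n) (S N) (\<mu> N)" if n: "N \<le> n" for n
  proof -
    obtain js T \<iota> \<rho> where js: "\<And>i. i \<in> set js \<Longrightarrow> m \<le> i"
      and T: "is_coproduct C (map (\<lambda>i. E (- i)) js) T \<iota>" and \<rho>: "is_epi C T (S n) \<rho>"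
      by (rule ample_cover[OF S, of m]) (rule that)
    have TO: "T \<in> Obj C" and \<iota>: "\<And>s. s < length js \<Longrightarrow> \<iota> s \<in> Hom C (E (- (js ! s))) T"
      using T by (auto simp: is_coproduct_def)
    have \<rho>h: "\<rho> \<in> Hom C T (S n)" using \<rho> by (simp add: is_epi_def)
    have "\<exists>g\<in>Hom C (E (- (js ! s))) (S N). \<mu> N \<cdot> g = \<mu> n \<cdot> (\<rho> \<cdot> \<iota> s)" if s: "s < length js" for s
    proof -
      have "\<mu> n \<cdot> (\<rho> \<cdot> \<iota> s) \<in> F n (js ! s)"
        unfolding F_def using cmp_closed[OF E_Obj TO S \<iota>[OF s] \<rho>h] by blast
      then have "\<mu> n \<cdot> (\<rho> \<cdot> \<iota> s) \<in> F N (js ! s)" using N[OF n js[of "js ! s"]] s by auto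
      then show ?thesis by (auto simp: F_def)
    qed
    then obtain g where g: "\<And>s. s < length js \<Longrightarrow> g s \<in> Hom C (E (- (js ! s))) (S N)"
      "\<And>s. s < length js \<Longrightarrow> \<mu> N \<cdot> g s = \<mu> n \<cdot> (\<rho> \<cdot> \<iota> s)" by metis
    then obtain h where h: "h \<in> Hom C T (S N)" "\<And>s. s < length js \<Longrightarrow> h \<cdot> \<iota> s = g s"
      using coproduct_ex1[OF T S[of N], of g] by blast
    have eq: "\<mu> N \<cdot> h = \<mu> n \<cdot> \<rho>"
    proof -
      have c: "\<mu> N \<cdot> h \<in> Hom C T X" "\<mu> n \<cdot> \<rho> \<in> Hom C T X"
        using cmp_closed[OF TO S X h(1) \<mu>] cmp_closed[OF TO S X \<rho>h \<mu>] by auto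
      have d: "(\<mu> n \<cdot> \<rho>) \<cdot> \<iota> s = \<mu> n \<cdot> (\<rho> \<cdot> \<iota> s)" "(\<mu> N \<cdot> h) \<cdot> \<iota> s = \<mu> n \<cdot> (\<rho> \<cdot> \<iota> s)" if s: "s < length js" for s
        using cmp_assoc[OF E_Obj TO S X \<iota>[OF s] \<rho>h \<mu>] cmp_assoc[OF E_Obj TO S X \<iota>[OF s] h(1) \<mu>] h(2)[OF s] g(2)[OF s]
        by simp_all
      have "\<mu> n \<cdot> (\<rho> \<cdot> \<iota> s) \<in> Hom C (E (- (js ! s))) X" if "s < length js" for s
        using cmp_closed[OF E_Obj TO X \<iota>[OF that] c(2)] d(1)[OF that] by simp
      then have "\<exists>!u. u \<in> Hom C T X \<and> (\<forall>s<length js. u \<cdot> \<iota> s = \<mu> n \<cdot> (\<rho> \<cdot> \<iota> s))"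
        by (intro coproduct_ex1[OF T X]) simp
      then show ?thesis using c d by blast
    qed
    \<comment> \<open>Descent along \<rho> uses that an epimorphism is a cokernel: \<open>h\<close>
      kills \<open>w\<close> because its composite with the monomorphism \<open>\<mu> N\<close>
      does.\<close>
    obtain W w where W: "W \<in> Obj C" "w \<in> Hom C W T" and cok: "is_cokernel C W T w (S n) \<rho>"
      using epi_is_cokernel[OF TO S \<rho>] by blast
    have hw: "h \<cdot> w \<in> Hom C W (S N)" by (rule cmp_closed[OF W(1) TO S W(2) h(1)])
    have "\<mu> N \<cdot> (h \<cdot> w) = \<mu> n \<cdot> (\<rho> \<cdot> w)"
      using cmp_assoc[OF W(1) TO S X W(2) h(1) \<mu>] cmp_assoc[OF W(1) TO S X W(2) \<rho>h \<mu>] eq by simp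
    also have "\<dots> = zero_mor C W X"
      using cok cmp_zero_right[OF W(1) S X \<mu>] by (simp add: is_cokernel_def)
    finally have "h \<cdot> w = zero_mor C W (S N)" using is_monoD[OF S X W(1) mono hw] by simp
    then obtain t where t: "t \<in> Hom C (S n) (S N)" "t \<cdot> \<rho> = h"
      using cok S[of N] h(1) unfolding is_cokernel_def by metis
    have "(\<mu> N \<cdot> t) \<cdot> \<rho> = \<mu> n \<cdot> \<rho>" using cmp_assoc[OF TO S S X \<rho>h t(1) \<mu>] t eq by simp
    then have "\<mu> N \<cdot> t = \<mu> n"
      using \<rho> X \<mu>[of n] cmp_closed[OF S S X t(1) \<mu>] unfolding is_epi_def by blast
    then show ?thesis using t unfolding subobject_le_def by blast
  qed
  then show "\<exists>N. \<forall>n\<ge>N. subobject_le C (S n) (\<mu> n) (S N) (\<mu> N)" by blast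
qed

text \<open>Induction on the number of summands of a cover \<pi> of \<open>X\<close>: the image in
  \<open>Hom(-, X)\<close> of the first \<open>r\<close> summands is contained in a noetherian
  subfunctor, and \<open>hom_subfunctor_extend\<close> adds the next summand. Once all summands are
  included, (A2) makes this subfunctor everything.\<close>

lemma acc_if_generators_acc:
  assumes accE: "\<And>i. acc_hom_subfunctors k C E i (E (- i)) (\<lambda>j. Hom C (E (- j)) (E (- i)))"
    and X: "X \<in> Obj C"
  shows "\<exists>m. acc_hom_subfunctors k C E m X (\<lambda>j. Hom C (E (- j)) X)"
proof -
  obtain js S \<iota> \<pi> where S: "is_coproduct C (map (\<lambda>i. E (- i)) js) S \<iota>" and \<pi>: "is_epi C S X \<pi>"
    by (rule ample_cover[OF X, of 0]) (rule that)
  have SO: "S \<in> Obj C" and \<iota>: "\<And>s. s < length js \<Longrightarrow> \<iota> s \<in> Hom C (E (- (js ! s))) S"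
    using S by (auto simp: is_coproduct_def)
  have \<pi>h: "\<pi> \<in> Hom C S X" using \<pi> by (simp add: is_epi_def)
  obtain m1 where m1: "\<And>i h. \<lbrakk>m1 \<le> i; h \<in> Hom C (E (- i)) X\<rbrakk> \<Longrightarrow> \<exists>h'\<in>Hom C (E (- i)) S. h = \<pi> \<cdot> h'"
    using ample_lift[OF SO X \<pi>] by blast
  \<comment> \<open>Beyond \<open>m1\<close> all morphisms to \<open>X\<close> lift to the cover;
    beyond all entries of \<open>js\<close> the extension lemma applies to every summand, as it
    requires \<open>i \<le> m\<close>.\<close>
  define m where "m = Max (insert m1 (set js))"
  have m1m: "m1 \<le> m" and jsm: "\<And>s. s < length js \<Longrightarrow> js ! s \<le> m" by (auto simp: m_def)
  have coprod_unique: "u = v" if "u \<in> Hom C S S" "v \<in> Hom C S S" "\<And>s. s < length js \<Longrightarrow> u \<cdot> \<iota> s = v \<cdot> \<iota> s" for u v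
  proof -
    have "\<exists>!u. u \<in> Hom C S S \<and> (\<forall>s<length js. u \<cdot> \<iota> s = v \<cdot> \<iota> s)"
      by (rule coproduct_ex1[OF S SO]) (rule cmp_closed[OF E_Obj SO SO \<iota> that(2)])
    then show ?thesis using that by blast
  qed
  \<comment> \<open>The endomorphism \<open>e\<close> is the projection of \<open>S\<close> onto its
    first \<open>r\<close> summands, described by its values on the injections.\<close>
  have "\<exists>G e. hom_subfunctor k C E m X G \<and> acc_hom_subfunctors k C E m X G \<and> e \<in> Hom C S S \<and>
      (\<forall>s<length js. e \<cdot> \<iota> s = (if s < r then \<iota> s else zero_mor C (E (- (js ! s))) S)) \<and>
      (\<forall>j\<ge>m. \<forall>h\<in>Hom C (E (- j)) S. \<pi> \<cdot> (e \<cdot> h) \<in> G j)" if "r \<le> length js" for r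
    using that
  proof (induction r)
    case 0
    define G where "G j = {zero_mor C (E (- j)) X}" for j
    have "hom_subfunctor k C E m X G"
      using submodule_zero_mor[OF E_Obj X] cmp_zero_left[OF E_Obj E_Obj X]
      by (simp add: hom_subfunctor_def G_def)
    moreover have "acc_hom_subfunctors k C E m X G"
      unfolding acc_hom_subfunctors_def
    proof (intro allI impI exI[of _ 0])
      fix F :: "nat \<Rightarrow> int \<Rightarrow> 'm set" and n j
      assume F: "\<forall>n. hom_subfunctor k C E m X (F n)" "\<forall>n. \<forall>j\<ge>m. F n j \<subseteq> G j" and j: "m \<le> j"
      have "zero_mor C (E (- j)) X \<in> F 0 j"
        by (rule hom_subfunctor_zero[where E = E, OF E_Obj X _ j]) (use F in blast)
      moreover have "F n j \<subseteq> {zero_mor C (E (- j)) X}" using F(2) j unfolding G_def by blast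
      ultimately show "F n j \<subseteq> F 0 j" by blast
    qed
    moreover have "\<pi> \<cdot> (zero_mor C S S \<cdot> h) \<in> G j" if "h \<in> Hom C (E (- j)) S" for j h
      using cmp_zero_left[OF E_Obj SO SO that] cmp_zero_right[OF E_Obj SO X \<pi>h] by (simp add: G_def)
    ultimately show ?case
      using zero_mor_closed[OF SO SO] cmp_zero_left[OF E_Obj SO SO \<iota>]
      by (intro exI[of _ G] exI[of _ "zero_mor C S S"]) simp
  next
    case (Suc r)
    then have r: "r < length js" by simp
    obtain G e where G: "hom_subfunctor k C E m X G" "acc_hom_subfunctors k C E m X G" and e: "e \<in> Hom C S S"
      and e\<iota>: "\<And>s. s < length js \<Longrightarrow> e \<cdot> \<iota> s = (if s < r then \<iota> s else zero_mor C (E (- (js ! s))) S)"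
      and eG: "\<And>j h. \<lbrakk>m \<le> j; h \<in> Hom C (E (- j)) S\<rbrakk> \<Longrightarrow> \<pi> \<cdot> (e \<cdot> h) \<in> G j"
      using Suc by auto
    \<comment> \<open>\<open>is_coproduct\<close> provides injections only. These Kronecker data
      define, by the universal property, the projection \<open>q\<close> onto summand
      \<open>r\<close>, which turns \<open>e\<close> into
      \<open>e' = e + \<iota> r \<cdot> q\<close>.\<close>
    define \<delta> where "\<delta> s = (if s = r then Id C (E (- (js ! r))) else zero_mor C (E (- (js ! s))) (E (- (js ! r))))" for s
    have "\<delta> s \<in> Hom C (E (- (js ! s))) (E (- (js ! r)))" if "s < length js" for s
      using Id_closed[OF E_Obj] zero_mor_closed[OF E_Obj E_Obj] by (simp add: \<delta>_def)
    then have "\<exists>!q. q \<in> Hom C S (E (- (js ! r))) \<and> (\<forall>s<length js. q \<cdot> \<iota> s = \<delta> s)"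
      by (rule coproduct_ex1[OF S E_Obj])
    then obtain q where q: "q \<in> Hom C S (E (- (js ! r)))" "\<And>s. s < length js \<Longrightarrow> q \<cdot> \<iota> s = \<delta> s" by blast
    define e' where "e' = add_mor C e (\<iota> r \<cdot> q)"
    have \<iota>q: "\<iota> r \<cdot> q \<in> Hom C S S" by (rule cmp_closed[OF SO E_Obj SO q(1) \<iota>[OF r]])
    have e': "e' \<in> Hom C S S" unfolding e'_def by (rule add_mor_closed[OF SO SO e \<iota>q])
    have \<pi>\<iota>: "\<pi> \<cdot> \<iota> r \<in> Hom C (E (- (js ! r))) X" by (rule cmp_closed[OF E_Obj SO X \<iota>[OF r] \<pi>h])
    let ?G = "\<lambda>j. {add_mor C b (\<pi> \<cdot> \<iota> r \<cdot> g) | b g. b \<in> G j \<and> g \<in> Hom C (E (- j)) (E (- (js ! r)))}"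
    note ext = hom_subfunctor_extend[OF E_Obj X \<pi>\<iota> jsm[OF r] G accE]
    have "e' \<cdot> \<iota> s = (if s < Suc r then \<iota> s else zero_mor C (E (- (js ! s))) S)" if s: "s < length js" for s
    proof -
      have "e' \<cdot> \<iota> s = add_mor C (e \<cdot> \<iota> s) (\<iota> r \<cdot> (q \<cdot> \<iota> s))"
        unfolding e'_def
        using cmp_add_left[OF E_Obj SO SO \<iota>[OF s] e \<iota>q] cmp_assoc[OF E_Obj SO E_Obj SO \<iota>[OF s] q(1) \<iota>[OF r]] by simp
      also have "\<dots> = add_mor C (if s < r then \<iota> s else zero_mor C (E (- (js ! s))) S)
          (if s = r then \<iota> r else zero_mor C (E (- (js ! s))) S)"
        using e\<iota>[OF s] q(2)[OF s] Id_right[OF E_Obj SO \<iota>[OF r]] cmp_zero_right[OF E_Obj E_Obj SO \<iota>[OF r]]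
        by (simp add: \<delta>_def)
      also have "\<dots> = (if s < Suc r then \<iota> s else zero_mor C (E (- (js ! s))) S)"
        using add_zero_left[OF E_Obj SO] add_zero_right[OF E_Obj SO] \<iota>[OF s] \<iota>[OF r] zero_mor_closed[OF E_Obj SO]
        by simp
      finally show ?thesis .
    qed
    moreover have "\<pi> \<cdot> (e' \<cdot> h) \<in> ?G j" if j: "m \<le> j" and h: "h \<in> Hom C (E (- j)) S" for j h
    proof -
      have qh: "q \<cdot> h \<in> Hom C (E (- j)) (E (- (js ! r)))" by (rule cmp_closed[OF E_Obj SO E_Obj h q(1)])
      have "e' \<cdot> h = add_mor C (e \<cdot> h) (\<iota> r \<cdot> (q \<cdot> h))"
        unfolding e'_def
        using cmp_add_left[OF E_Obj SO SO h e \<iota>q] cmp_assoc[OF E_Obj SO E_Obj SO h q(1) \<iota>[OF r]] by simp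
      then have "\<pi> \<cdot> (e' \<cdot> h) = add_mor C (\<pi> \<cdot> (e \<cdot> h)) (\<pi> \<cdot> (\<iota> r \<cdot> (q \<cdot> h)))"
        using cmp_add_right[OF E_Obj SO X cmp_closed[OF E_Obj SO SO h e] cmp_closed[OF E_Obj E_Obj SO qh \<iota>[OF r]] \<pi>h] by simp
      also have "\<pi> \<cdot> (\<iota> r \<cdot> (q \<cdot> h)) = \<pi> \<cdot> \<iota> r \<cdot> (q \<cdot> h)"
        using cmp_assoc[OF E_Obj E_Obj SO X qh \<iota>[OF r] \<pi>h] by simp
      finally show ?thesis using eG[OF j h] qh by blast
    qed
    ultimately show ?case using ext e' by (intro exI[of _ ?G] exI[of _ e']) blast
  qed
  from this[OF le_refl] obtain G e where G: "acc_hom_subfunctors k C E m X G" and e: "e \<in> Hom C S S"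
    "\<And>s. s < length js \<Longrightarrow> e \<cdot> \<iota> s = \<iota> s" "\<And>j h. \<lbrakk>m \<le> j; h \<in> Hom C (E (- j)) S\<rbrakk> \<Longrightarrow> \<pi> \<cdot> (e \<cdot> h) \<in> G j"
    by auto
  have "e = Id C S"
    using coprod_unique[OF e(1) Id_closed[OF SO]] e(2) Id_left[OF E_Obj SO \<iota>] by simp
  \<comment> \<open>A morphism to \<open>X\<close> in degree \<open>j \<ge> m1\<close> is
    \<open>\<pi> \<cdot> h'\<close>, and inserting \<open>e = Id C S\<close> before
    \<open>h'\<close> puts it in \<open>G j\<close>.\<close>
  then have HG: "Hom C (E (- j)) X \<subseteq> G j" if "m \<le> j" for j
    using e(3)[OF that] m1[of j] that m1m Id_left[OF E_Obj SO, of _ "- j"] by fastforce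
  have "acc_hom_subfunctors k C E m X (\<lambda>j. Hom C (E (- j)) X)"
    unfolding acc_hom_subfunctors_def
  proof (intro allI impI)
    fix F assume F: "\<forall>n::nat. hom_subfunctor k C E m X (F n)" "\<forall>n. \<forall>j\<ge>m. F n j \<subseteq> F (Suc n) j"
      "\<forall>n. \<forall>j\<ge>m. F n j \<subseteq> Hom C (E (- j)) X"
    then have "\<forall>n. \<forall>j\<ge>m. F n j \<subseteq> G j" using HG by blast
    then show "\<exists>N. \<forall>n\<ge>N. \<forall>j\<ge>m. F n j \<subseteq> F N j"
      using G F unfolding acc_hom_subfunctors_def by blast
  qed
  then show ?thesis by blast
qed

end

section \<open>From noetherian objects to chains of subfunctors\<close>

context ample_sequence
begin

text \<open>Choose a subobject of \<open>X\<close> maximal among those on which \<open>F\<close> contains all morphisms from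
  \<open>E (- j)\<close>, \<open>j\<close> large. Every element of \<open>F\<close> then factors through it, as one sees by adding the
  image of that element and lifting along the resulting epimorphism.\<close>

lemma acc_if_noetherian_object:
  assumes fin: "hom_finite k C" and noeth: "noetherian_object C X"
  shows "acc_hom_subfunctors k C E m X G"
  unfolding acc_hom_subfunctors_def
proof (intro allI impI)
  fix F :: "nat \<Rightarrow> int \<Rightarrow> 'm set"
  assume "\<forall>n. hom_subfunctor k C E m X (F n)" "\<forall>n. \<forall>j\<ge>m. F n j \<subseteq> F (Suc n) j"
  then have F: "\<And>n. hom_subfunctor k C E m X (F n)" and inc: "\<And>n j. m \<le> j \<Longrightarrow> F n j \<subseteq> F (Suc n) j"
    by auto
  have X: "X \<in> Obj C" using noeth by (simp add: noetherian_object_def)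
  have mono: "F n j \<subseteq> F n' j" if "n \<le> n'" "m \<le> j" for n n' j
    using lift_Suc_mono_le[of "\<lambda>n. F n j", OF inc[OF that(2)] that(1)] .
  note FH = hom_subfunctor_subset[OF E_Obj X F, THEN subsetD]
  \<comment> \<open>The bound \<open>m0\<close> may depend on the subobject. This freedom is needed
    because each enlargement below invokes (A2) for a new epimorphism.\<close>
  define Q where "Q n S \<mu> \<longleftrightarrow> S \<in> Obj C \<and> is_mono C S X \<mu> \<and>
    (\<exists>m0\<ge>m. \<forall>j\<ge>m0. \<forall>h\<in>Hom C (E (- j)) S. \<mu> \<cdot> h \<in> F n j)" for n S \<mu>
  have enlarge: "\<exists>n' S' \<mu>'. Q n' S' \<mu>' \<and> subobject_le C S \<mu> S' \<mu>' \<and> (\<exists>h\<in>Hom C (E (- j)) S'. \<mu>' \<cdot> h = f)"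
    if Q: "Q n S \<mu>" and j: "m \<le> j" and f: "f \<in> F n1 j" for n S \<mu> j f n1
  proof -
    have S: "S \<in> Obj C" and \<mu>: "\<mu> \<in> Hom C S X" using Q by (auto simp: Q_def is_mono_def)
    obtain m0 where m0: "m \<le> m0" "\<And>j h. \<lbrakk>m0 \<le> j; h \<in> Hom C (E (- j)) S\<rbrakk> \<Longrightarrow> \<mu> \<cdot> h \<in> F n j"
      using Q by (auto simp: Q_def)
    have fh: "f \<in> Hom C (E (- j)) X" using FH[OF j f] .
    obtain B i1 i2 p1 p2 where "is_biproduct C S (E (- j)) B i1 i2 p1 p2"
      using biproduct_exists[OF S E_Obj] by blast
    then have B: "B \<in> Obj C" "i1 \<in> Hom C S B" "i2 \<in> Hom C (E (- j)) B" "p1 \<in> Hom C B S" "p2 \<in> Hom C B (E (- j))"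
      and Bid: "p1 \<cdot> i1 = Id C S" "p2 \<cdot> i2 = Id C (E (- j))" "p1 \<cdot> i2 = zero_mor C (E (- j)) S"
        "p2 \<cdot> i1 = zero_mor C S (E (- j))"
      by (auto simp: is_biproduct_def)
    \<comment> \<open>The image of this map from the biproduct of \<open>S\<close> and
      \<open>E (- j)\<close> is the sum of the subobject \<mu> and the image of \<open>f\<close>; it
      is the enlarged subobject.\<close>
    define \<phi> where "\<phi> = add_mor C (\<mu> \<cdot> p1) (f \<cdot> p2)"
    have \<mu>p: "\<mu> \<cdot> p1 \<in> Hom C B X" by (rule cmp_closed[OF B(1) S X B(4) \<mu>])
    have fp: "f \<cdot> p2 \<in> Hom C B X" by (rule cmp_closed[OF B(1) E_Obj X B(5) fh])
    have \<phi>: "\<phi> \<in> Hom C B X" unfolding \<phi>_def by (rule add_mor_closed[OF B(1) X \<mu>p fp])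
    have \<phi>_cmp: "\<phi> \<cdot> h = add_mor C (\<mu> \<cdot> (p1 \<cdot> h)) (f \<cdot> (p2 \<cdot> h))" if "W \<in> Obj C" "h \<in> Hom C W B" for W h
      unfolding \<phi>_def
      using cmp_add_left[OF that(1) B(1) X that(2) \<mu>p fp] cmp_assoc[OF that(1) B(1) S X that(2) B(4) \<mu>]
        cmp_assoc[OF that(1) B(1) E_Obj X that(2) B(5) fh] by simp
    have \<phi>i1: "\<phi> \<cdot> i1 = \<mu>"
      using \<phi>_cmp[OF S B(2)] Bid Id_right[OF S X \<mu>] cmp_zero_right[OF S E_Obj X fh] add_zero_right[OF S X \<mu>] by simp
    have \<phi>i2: "\<phi> \<cdot> i2 = f"
      using \<phi>_cmp[OF E_Obj B(3)] Bid Id_right[OF E_Obj X fh] cmp_zero_right[OF E_Obj S X \<mu>] add_zero_left[OF E_Obj X fh] by simp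
    obtain S' \<mu>' e where S': "S' \<in> Obj C" and \<mu>': "is_mono C S' X \<mu>'" and e: "is_epi C B S' e" "\<mu>' \<cdot> e = \<phi>"
      using image_factorization[OF B(1) X \<phi>] .
    have \<mu>'h: "\<mu>' \<in> Hom C S' X" and eh: "e \<in> Hom C B S'" using \<mu>' e by (auto simp: is_mono_def is_epi_def)
    obtain m1 where m1: "\<And>i h. \<lbrakk>m1 \<le> i; h \<in> Hom C (E (- i)) S'\<rbrakk> \<Longrightarrow> \<exists>h'\<in>Hom C (E (- i)) B. h = e \<cdot> h'"
      using ample_lift[OF B(1) S' e(1)] by blast
    \<comment> \<open>Beyond \<open>m1\<close> morphisms to the image lift to the biproduct, beyond
      \<open>m0\<close> the \<mu>-part lies in \<open>F n\<close>, and beyond \<open>j\<close> the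
      \<open>f\<close>-part is a multiple of \<open>f\<close> within the subfunctor.\<close>
    define m2 where "m2 = max (max m0 j) m1"
    define n2 where "n2 = max n n1"
    have "\<mu>' \<cdot> h \<in> F n2 t" if t: "m2 \<le> t" and h: "h \<in> Hom C (E (- t)) S'" for t h
    proof -
      have mt: "m \<le> t" using t m0 by (simp add: m2_def)
      obtain h' where h': "h' \<in> Hom C (E (- t)) B" "h = e \<cdot> h'" using m1[of t h] t h by (auto simp: m2_def)
      have p1h: "p1 \<cdot> h' \<in> Hom C (E (- t)) S" by (rule cmp_closed[OF E_Obj B(1) S h'(1) B(4)])
      have p2h: "p2 \<cdot> h' \<in> Hom C (E (- t)) (E (- j))" by (rule cmp_closed[OF E_Obj B(1) E_Obj h'(1) B(5)])
      have "\<mu>' \<cdot> h = add_mor C (\<mu> \<cdot> (p1 \<cdot> h')) (f \<cdot> (p2 \<cdot> h'))"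
        using cmp_assoc[OF E_Obj B(1) S' X h'(1) eh \<mu>'h] e h' \<phi>_cmp[OF E_Obj h'(1)] by simp
      moreover have "\<mu> \<cdot> (p1 \<cdot> h') \<in> F n2 t"
        using m0(2)[OF _ p1h] t mono[of n n2 t] mt by (auto simp: m2_def n2_def)
      moreover have "f \<cdot> (p2 \<cdot> h') \<in> F n2 t"
        using hom_subfunctor_closed[OF F j _ f p2h] t mono[of n1 n2 t] mt by (auto simp: m2_def n2_def)
      ultimately show ?thesis using hom_subfunctor_add[OF E_Obj X F mt] by simp
    qed
    moreover have "m \<le> m2" using m0 by (simp add: m2_def)
    ultimately have "Q n2 S' \<mu>'" using S' \<mu>' unfolding Q_def by blast
    moreover have "subobject_le C S \<mu> S' \<mu>'"
      unfolding subobject_le_def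
      using cmp_closed[OF S B(1) S' B(2) eh] cmp_assoc[OF S B(1) S' X B(2) eh \<mu>'h] e \<phi>i1 by auto
    moreover have "\<exists>h\<in>Hom C (E (- j)) S'. \<mu>' \<cdot> h = f"
      using cmp_closed[OF E_Obj B(1) S' B(3) eh] cmp_assoc[OF E_Obj B(1) S' X B(3) eh \<mu>'h] e \<phi>i2 by auto
    ultimately show ?thesis by blast
  qed
  \<comment> \<open>Maximality is taken over all indices \<open>n'\<close>, not for a fixed one,
    since an enlargement by an element of a later member changes the index. Otherwise dependent
    choice, started at the zero subobject, would give a strictly increasing chain of subobjects of
    \<open>X\<close>.\<close>
  have "\<exists>n S \<mu>. Q n S \<mu> \<and> (\<forall>n' S' \<mu>'. Q n' S' \<mu>' \<longrightarrow> subobject_le C S \<mu> S' \<mu>' \<longrightarrow> subobject_le C S' \<mu>' S \<mu>)"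
  proof (rule ccontr)
    assume contr: "\<not> ?thesis"
    define R where "R = (\<lambda>(S, \<mu>). \<exists>n. Q n S \<mu>)"
    define L where "L = (\<lambda>(S, \<mu>) (S', \<mu>'). subobject_le C S \<mu> S' \<mu>')"
    obtain Z where Z: "is_zero_object C Z" using zero_object_exists by blast
    then have ZO: "Z \<in> Obj C" by (simp add: is_zero_object_def)
    have "is_mono C Z X (zero_mor C Z X)"
      using Z zero_mor_closed[OF _ ZO] by (intro is_monoI[OF ZO X zero_mor_closed[OF ZO X]])
        (auto simp: is_zero_object_def)
    moreover have "zero_mor C Z X \<cdot> h \<in> F 0 j" if "m \<le> j" "h \<in> Hom C (E (- j)) Z" for j h
      using cmp_zero_left[OF E_Obj ZO X that(2)] hom_subfunctor_zero[OF E_Obj X F that(1)] by simp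
    ultimately have "R (Z, zero_mor C Z X)" using ZO unfolding R_def Q_def by blast
    moreover have "\<exists>y. R y \<and> (L x y \<and> \<not> L y x)" if "R x" for x
      using contr that by (force simp: R_def L_def)
    ultimately obtain x where x: "\<And>n::nat. R (x n)" "\<And>n. L (x n) (x (Suc n))" "\<And>n. \<not> L (x (Suc n)) (x n)"
      using dependent_nat_choice[of "\<lambda>_. R" "\<lambda>_ x y. L x y \<and> \<not> L y x"] by metis
    have "\<exists>N. \<forall>n\<ge>N. subobject_le C (fst (x n)) (snd (x n)) (fst (x N)) (snd (x N))"
    proof -
      have "fst (x n) \<in> Obj C \<and> is_mono C (fst (x n)) X (snd (x n))" for n
        using x(1)[of n] by (auto simp: R_def Q_def split: prod.splits)
      moreover have "subobject_le C (fst (x n)) (snd (x n)) (fst (x (Suc n))) (snd (x (Suc n)))" for n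
        using x(2)[of n] by (simp add: L_def case_prod_beta)
      ultimately show ?thesis
        using noeth[unfolded noetherian_object_def, THEN conjunct2, rule_format,
            of "\<lambda>n. fst (x n)" "\<lambda>n. snd (x n)"] by blast
    qed
    then obtain N where "subobject_le C (fst (x (Suc N))) (snd (x (Suc N))) (fst (x N)) (snd (x N))"
      by (meson le_SucI le_refl)
    then have "L (x (Suc N)) (x N)" by (simp add: L_def case_prod_beta)
    then show False using x(3) by blast
  qed
  then obtain n0 S \<mu> where Q: "Q n0 S \<mu>"
    and max: "\<And>n' S' \<mu>'. \<lbrakk>Q n' S' \<mu>'; subobject_le C S \<mu> S' \<mu>'\<rbrakk> \<Longrightarrow> subobject_le C S' \<mu>' S \<mu>" by blast
  then obtain m0 where S: "S \<in> Obj C" "\<mu> \<in> Hom C S X"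
    and m0: "m \<le> m0" "\<And>j h. \<lbrakk>m0 \<le> j; h \<in> Hom C (E (- j)) S\<rbrakk> \<Longrightarrow> \<mu> \<cdot> h \<in> F n0 j"
    by (auto simp: Q_def is_mono_def)
  \<comment> \<open>Enlarging by \<open>f\<close> stays inside the maximal subobject, so
    \<open>f\<close> factors through \<mu>; as \<open>j \<ge> m0\<close>, this already places it in
    \<open>F n0 j\<close>, whatever \<open>n\<close> is.\<close>
  have large: "F n j \<subseteq> F n0 j" if j: "m0 \<le> j" for n j
  proof
    fix f assume f: "f \<in> F n j"
    obtain n' S' \<mu>' where *: "Q n' S' \<mu>'" "subobject_le C S \<mu> S' \<mu>'" "\<exists>h\<in>Hom C (E (- j)) S'. \<mu>' \<cdot> h = f"
      using enlarge[OF Q _ f] j m0 by auto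
    then obtain h t where h: "h \<in> Hom C (E (- j)) S'" "\<mu>' \<cdot> h = f" and t: "t \<in> Hom C S' S" "\<mu> \<cdot> t = \<mu>'"
      using max unfolding subobject_le_def by blast
    have S': "S' \<in> Obj C" using * by (simp add: Q_def)
    have "f = \<mu> \<cdot> (t \<cdot> h)" using cmp_assoc[OF E_Obj S' S(1) X h(1) t(1) S(2)] h t by simp
    then show "f \<in> F n0 j" using m0(2)[OF j] cmp_closed[OF E_Obj S' S(1) h(1) t(1)] by simp
  qed
  have "\<exists>N. \<forall>n. F n j \<subseteq> F N j" if j: "m \<le> j" for j
  proof -
    interpret V: vectorspace k "hom_space C (E (- j)) X" by (rule hom_vectorspace[OF E_Obj X])
    have "V.fin_dim" using fin E_Obj X by (simp add: hom_finite_def)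
    then show ?thesis
      using V.fin_dim_subspace_chain[of "\<lambda>n. F n j"] hom_subfunctor_submodule[OF F j] inc[OF j] by simp
  qed
  then obtain M where M: "\<And>j n. m \<le> j \<Longrightarrow> F n j \<subseteq> F (M j) j" by metis
  \<comment> \<open>One index \<open>n0\<close> serves all degrees from \<open>m0\<close> on, and
    each of the finitely many degrees in \<open>{m..<m0}\<close> contributes its own
    \<open>M j\<close>.\<close>
  define N where "N = Max (insert n0 (M ` {m..<m0}))"
  have "F n j \<subseteq> F N j" if j: "m \<le> j" for n j
  proof (cases "m0 \<le> j")
    case True
    have "n0 \<le> N" by (simp add: N_def)
    then show ?thesis using large[OF True, of n] mono[of n0 N j] j by blast
  next
    case False
    then have "M j \<le> N" using j unfolding N_def by (intro Max_ge) auto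
    then show ?thesis using M[OF j, of n] mono[of "M j" N j] j by blast
  qed
  then show "\<exists>N. \<forall>n\<ge>N. \<forall>j\<ge>m. F n j \<subseteq> F N j" by blast
qed

text \<open>The implications form the cycle (1) => (2) => (3) => (1), so that (2) => (1) and (3) =>
  (2) come from composition.\<close>

theorem noetherian_equivalences:
  assumes "hom_finite k C"
  shows "right_noetherian k (zalg_nonneg (zalg_of C E)) \<longleftrightarrow> noetherian_category C"
    and "noetherian_category C \<longleftrightarrow> (\<forall>i. noetherian_object C (E i))"
proof -
  note rn = right_noetherian_zalg_iff[where E = E, OF E_Obj]
  have "noetherian_category C" if "right_noetherian k (zalg_nonneg (zalg_of C E))"
    unfolding noetherian_category_def
    using acc_if_generators_acc that[unfolded rn] noetherian_object_if_acc by blast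
  moreover have "right_noetherian k (zalg_nonneg (zalg_of C E))" if "\<forall>i. noetherian_object C (E i)"
    unfolding rn using acc_if_noetherian_object[OF assms] that by blast
  moreover have "\<forall>i. noetherian_object C (E i)" if "noetherian_category C"
    using that E_Obj by (simp add: noetherian_category_def)
  ultimately show "right_noetherian k (zalg_nonneg (zalg_of C E)) \<longleftrightarrow> noetherian_category C"
    "noetherian_category C \<longleftrightarrow> (\<forall>i. noetherian_object C (E i))" by blast+
qed

end

theorem theorem6p5:
  fixes k :: "('k, 'r) ring_scheme"
    and C :: "('o, 'm, 'k, 'z) lin_category_scheme"
    and \<omega> :: "('o, 'm) bimodule"
    and E :: "int \<Rightarrow> 'o"
    and l :: int
  assumes "field k"
    and "abelian_category k C"
    and "hom_finite k C"
    and "canonical_bimodule k C \<omega>"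
    and "ample C E"
    and "helix k C \<omega> l (\<lambda>i. stalk C (E i))"
    and "geometric C (\<lambda>i. stalk C (E i))"
    and "full C l (\<lambda>i. stalk C (E i))"
  shows "(right_noetherian k (zalg_nonneg (zalg_of C E)) \<longleftrightarrow> noetherian_category C) \<and>
         (noetherian_category C \<longleftrightarrow> (\<forall>i. noetherian_object C (E i)))"
proof -
  interpret ample_sequence k C E
    using assms by (intro ample_sequence.intro ample_sequence_axioms.intro)
  show ?thesis using noetherian_equivalences assms by blast
qed

end
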